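(* Let $(R,\mathfrak m)$ be a Noetherian local ring, let $G\simeq R^e$ with $e>0$, and let $E\subsetneq G$ be a proper $R$-submodule. Then $\operatorname{depth} G_n/E_n$ takes a constant value for large $n$; that is, there is an integer $n_0$ such that $\operatorname{depth} G_n/E_n=\operatorname{depth} G_{n_0}/E_{n_0}$ for all $n\ge n_0$.
   Context: For an $R$-submodule $E$ of a free module $G\simeq R^e$, the Rees algebra $\mathcal R_G(E)=\bigoplus_{n\ge0}E_n$ is the image of the natural graded map of symmetric algebras $\mathcal S_R(E)\to\mathcal S_R(G)\simeq R[t_1,\dots,t_e]$, and $G_n=\mathcal S_R(G)_n$. Thus $E_0=R$ and $E_n\subset G_n$ is the $R$-submodule generated by all products of $n$ elements of $E$. Depth is with respect to $\mathfrak m$. *)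

theory Defs
  imports
    "HOL-Analysis.Finite_Cartesian_Product"
    "HOL-Library.Poly_Mapping"
    "HOL-Library.Extended_Nat"
begin

text \<open>
  The base ring is a type of class \<open>comm_ring_1\<close> (in particular \<open>0 \<noteq> 1\<close>); its ideals are its
  submodules when it is regarded as a module over itself.
\<close>

definition maximal_ideal :: "'a::comm_ring_1 set \<Rightarrow> bool" where
  "maximal_ideal \<mm> \<longleftrightarrow>
     module.subspace (*) \<mm> \<and> \<mm> \<noteq> UNIV \<and>
     (\<forall>J. module.subspace (*) J \<and> \<mm> \<subseteq> J \<longrightarrow> J = \<mm> \<or> J = UNIV)"

definition noetherian_local_ring :: "'a::comm_ring_1 set \<Rightarrow> bool" where
  "noetherian_local_ring \<mm> \<longleftrightarrow>
     (\<forall>I :: 'a set. module.subspace (*) I \<longrightarrow> (\<exists>B. finite B \<and> I = module.span (*) B)) \<and>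
     maximal_ideal \<mm> \<and> (\<forall>\<nn>. maximal_ideal \<nn> \<longrightarrow> \<nn> = \<mm>)"


text \<open>
  Depth of a quotient module \<open>N / L\<close>, where \<open>L \<subseteq> N\<close> are submodules of an ambient module with scalar
  multiplication \<open>s\<close>. Elements of \<open>N / L\<close> are handled through representatives in \<open>N\<close>:
  \<open>ideal_mult s N L xs\<close> is the preimage \<open>L + (x\<^sub>1, \<dots>, x\<^sub>k) N\<close> in \<open>N\<close> of the submodule
  \<open>(x\<^sub>1, \<dots>, x\<^sub>k) (N / L)\<close>, so that membership in it means being zero in
  \<open>(N / L) / (x\<^sub>1, \<dots>, x\<^sub>k) (N / L)\<close>. Lemma \<open>depth_quotient_cong\<close> below shows that the result
  depends only on the module \<open>N / L\<close>. The depth of \<open>N\<close> itself is the case \<open>L = {0}\<close>.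
\<close>

definition ideal_mult ::
    "('a::comm_ring_1 \<Rightarrow> 'b::ab_group_add \<Rightarrow> 'b) \<Rightarrow> 'b set \<Rightarrow> 'b set \<Rightarrow> 'a list \<Rightarrow> 'b set" where
  "ideal_mult s N L xs = module.span s (L \<union> {s x v | x v. x \<in> set xs \<and> v \<in> N})"

definition regular_sequence ::
    "('a::comm_ring_1 \<Rightarrow> 'b::ab_group_add \<Rightarrow> 'b) \<Rightarrow> 'b set \<Rightarrow> 'b set \<Rightarrow> 'a list \<Rightarrow> bool" where
  "regular_sequence s N L xs \<longleftrightarrow>
     (\<forall>i < length xs. \<forall>v \<in> N. s (xs ! i) v \<in> ideal_mult s N L (take i xs)
        \<longrightarrow> v \<in> ideal_mult s N L (take i xs)) \<and>
     ideal_mult s N L xs \<noteq> N"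

text \<open>The zero module has depth \<open>\<infinity>\<close>.\<close>

definition depth_quotient ::
    "('a::comm_ring_1 \<Rightarrow> 'b::ab_group_add \<Rightarrow> 'b) \<Rightarrow> 'a set \<Rightarrow> 'b set \<Rightarrow> 'b set \<Rightarrow> enat" where
  "depth_quotient s \<mm> N L =
     (if N = L then \<infinity>
      else Sup {enat (length xs) | xs. set xs \<subseteq> \<mm> \<and> regular_sequence s N L xs})"

lemma depth_quotient_cong:
  fixes s :: "'a::comm_ring_1 \<Rightarrow> 'b::ab_group_add \<Rightarrow> 'b"
    and s' :: "'a \<Rightarrow> 'c::ab_group_add \<Rightarrow> 'c"
  assumes "module s" "module s'"
    and N: "module.subspace s N" and L: "module.subspace s L" and LN: "L \<subseteq> N"
    and add: "\<And>u v. u \<in> N \<Longrightarrow> v \<in> N \<Longrightarrow> f (u + v) = f u + f v"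
    and scale: "\<And>r v. v \<in> N \<Longrightarrow> f (s r v) = s' r (f v)"
    and ker: "\<And>v. v \<in> N \<Longrightarrow> f v = 0 \<longleftrightarrow> v \<in> L"
  shows "depth_quotient s \<mm> N L = depth_quotient s' \<mm> (f ` N) {0}"
proof -
  interpret A: module s by fact
  interpret B: module s' by fact
  have f0: "f 0 = 0" using ker A.subspace_0[OF L] A.subspace_0[OF N] by blast
  have fN: "B.subspace (f ` N)"
  proof (rule B.subspaceI)
    show "0 \<in> f ` N" using f0 A.subspace_0[OF N] by force
  next
    fix x y assume "x \<in> f ` N" "y \<in> f ` N"
    then show "x + y \<in> f ` N" using add A.subspace_add[OF N] by (metis (no_types, lifting) image_iff)
  next
    fix c x assume "x \<in> f ` N"
    then show "s' c x \<in> f ` N" using scale A.subspace_scale[OF N] by (metis (no_types, lifting) image_iff)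
  qed
  have sub: "ideal_mult s N L xs \<subseteq> N" for xs
    unfolding ideal_mult_def
    by (rule A.span_minimal) (use LN N A.subspace_scale in auto)
  have sub': "ideal_mult s' (f ` N) {0} xs \<subseteq> f ` N" for xs
    unfolding ideal_mult_def
    by (rule B.span_minimal) (use fN B.subspace_scale B.subspace_0 in auto)
  have im1: "f v \<in> ideal_mult s' (f ` N) {0} xs" if "v \<in> ideal_mult s N L xs" for v xs
  proof -
    let ?T = "{v \<in> N. f v \<in> ideal_mult s' (f ` N) {0} xs}"
    have "ideal_mult s N L xs \<subseteq> ?T"
      unfolding ideal_mult_def[of s]
    proof (rule A.span_minimal)
      show "A.subspace ?T"
        unfolding ideal_mult_def
        by (rule A.subspaceI)
          (auto simp: f0 add scale A.subspace_0[OF N] A.subspace_add[OF N] A.subspace_scale[OF N]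
            B.span_zero intro: B.span_add B.span_scale)
      show "L \<union> {s x v |x v. x \<in> set xs \<and> v \<in> N} \<subseteq> ?T"
      proof
        fix w assume w: "w \<in> L \<union> {s x v |x v. x \<in> set xs \<and> v \<in> N}"
        then have wN: "w \<in> N" using LN A.subspace_scale[OF N] by auto
        from w have "f w \<in> {0} \<union> {s' x v |x v. x \<in> set xs \<and> v \<in> f ` N}"
          using LN ker scale by blast
        then have "f w \<in> ideal_mult s' (f ` N) {0} xs"
          unfolding ideal_mult_def by (rule B.span_base)
        with wN show "w \<in> ?T" by simp
      qed
    qed
    with that show ?thesis by blast
  qed
  have im2: "v \<in> ideal_mult s N L xs"
    if v: "v \<in> N" and fv: "f v \<in> ideal_mult s' (f ` N) {0} xs" for v xs
  proof -
    let ?T = "f ` ideal_mult s N L xs"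
    have Isub: "A.subspace (ideal_mult s N L xs)" unfolding ideal_mult_def by simp
    have "ideal_mult s' (f ` N) {0} xs \<subseteq> ?T"
      unfolding ideal_mult_def[of s']
    proof (rule B.span_minimal)
      show "B.subspace ?T"
      proof (rule B.subspaceI)
        show "0 \<in> ?T" using f0 A.subspace_0[OF Isub] by force
      next
        fix x y assume "x \<in> ?T" "y \<in> ?T"
        then obtain u w where "u \<in> ideal_mult s N L xs" "w \<in> ideal_mult s N L xs"
          "x = f u" "y = f w" by blast
        moreover then have "x + y = f (u + w)" using add sub by (metis subsetD)
        ultimately show "x + y \<in> ?T" using A.subspace_add[OF Isub] by blast
      next
        fix c x assume "x \<in> ?T"
        then obtain u where "u \<in> ideal_mult s N L xs" "x = f u" by blast
        moreover then have "s' c x = f (s c u)" using scale sub by (metis subsetD)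
        ultimately show "s' c x \<in> ?T" using A.subspace_scale[OF Isub] by blast
      qed
      show "{0} \<union> {s' x v |x v. x \<in> set xs \<and> v \<in> f ` N} \<subseteq> ?T"
      proof
        fix y assume "y \<in> {0} \<union> {s' x v |x v. x \<in> set xs \<and> v \<in> f ` N}"
        then consider "y = 0" | x v where "y = s' x (f v)" "x \<in> set xs" "v \<in> N" by blast
        then show "y \<in> ?T"
        proof cases
          case 1
          then show ?thesis using f0 A.subspace_0[OF Isub] by force
        next
          case 2
          then have "s x v \<in> ideal_mult s N L xs"
            unfolding ideal_mult_def by (intro A.span_base) blast
          then show ?thesis using 2 scale by (metis image_eqI)
        qed
      qed
    qed
    with fv obtain u where u: "u \<in> ideal_mult s N L xs" "f u = f v" by fastforce
    then have uN: "u \<in> N" using sub by blast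
    have vu: "v - u \<in> N" using A.subspace_diff[OF N v uN] .
    have "f v = f (v - u) + f u" using add[OF vu uN] by simp
    then have "v - u \<in> L" using u ker[OF vu] by simp
    then have "v - u \<in> ideal_mult s N L xs"
      unfolding ideal_mult_def by (intro A.span_base) blast
    then show ?thesis using A.subspace_add[OF Isub _ u(1)] by force
  qed
  have iff: "v \<in> ideal_mult s N L xs \<longleftrightarrow> f v \<in> ideal_mult s' (f ` N) {0} xs" if "v \<in> N" for v xs
    using im1 im2 that by blast
  have ne: "ideal_mult s N L xs = N \<longleftrightarrow> ideal_mult s' (f ` N) {0} xs = f ` N" for xs
    using iff[of _ xs] sub[of xs] sub'[of xs] by blast
  have reg: "regular_sequence s N L xs \<longleftrightarrow> regular_sequence s' (f ` N) {0} xs" for xs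
  proof -
    have "(s (xs ! i) v \<in> ideal_mult s N L (take i xs)) \<longleftrightarrow>
          (s' (xs ! i) (f v) \<in> ideal_mult s' (f ` N) {0} (take i xs))" if "v \<in> N" for i v
      using iff[OF A.subspace_scale[OF N that]] scale[OF that] by simp
    then show ?thesis
      unfolding regular_sequence_def ne by (auto simp: iff)
  qed
  have "N = L \<longleftrightarrow> f ` N = {0}"
    using ker LN f0 A.subspace_0[OF N] by (auto simp: image_iff)
  then show ?thesis
    unfolding depth_quotient_def reg by simp
qed


text \<open>
  The polynomial ring \<open>R[t\<^sub>i | i \<in> 'e]\<close> is \<open>('e \<Rightarrow>\<^sub>0 nat) \<Rightarrow>\<^sub>0 'a\<close>: finitely supported functions from
  exponent vectors to coefficients.
\<close>

type_synonym ('a, 'e) polyring = "('e \<Rightarrow>\<^sub>0 nat) \<Rightarrow>\<^sub>0 'a"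

definition poly_scale :: "'a::comm_ring_1 \<Rightarrow> ('a, 'e) polyring \<Rightarrow> ('a, 'e) polyring" where
  "poly_scale r p = Poly_Mapping.single 0 r * p"

text \<open>\<open>Sym_pow n\<close> is \<open>G\<^sub>n\<close>, the homogeneous polynomials of degree \<open>n\<close>.\<close>

definition Sym_pow :: "nat \<Rightarrow> ('a::comm_ring_1, 'e::finite) polyring set" where
  "Sym_pow n = {p. \<forall>k \<in> Poly_Mapping.keys p. (\<Sum>i\<in>UNIV. Poly_Mapping.lookup k i) = n}"

text \<open>The identification of \<open>G = R\<^sup>e\<close> with \<open>G\<^sub>1\<close>, sending the \<open>i\<close>-th unit vector to \<open>t\<^sub>i\<close>.\<close>

definition linear_form :: "'a::comm_ring_1 ^ 'e::finite \<Rightarrow> ('a, 'e) polyring" where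
  "linear_form v = (\<Sum>i\<in>UNIV. Poly_Mapping.single (Poly_Mapping.single i 1) (v $ i))"

text \<open>\<open>Rees_pow E n\<close> is \<open>E\<^sub>n\<close>; for \<open>n = 0\<close> the only product is the empty one, so \<open>E\<^sub>0 = R\<close>.\<close>

definition Rees_pow :: "('a::comm_ring_1 ^ 'e::finite) set \<Rightarrow> nat \<Rightarrow> ('a, 'e) polyring set" where
  "Rees_pow E n =
     module.span poly_scale {\<Prod>v\<leftarrow>vs. linear_form v | vs. length vs = n \<and> set vs \<subseteq> E}"

lemma module_poly_scale:
  "module (poly_scale :: 'a::comm_ring_1 \<Rightarrow> ('a, 'e) polyring \<Rightarrow> ('a, 'e) polyring)"
  by standard
    (simp_all add: poly_scale_def distrib_left distrib_right single_add mult_single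
      flip: mult.assoc)

lemma module_vector_scalar_mult:
  "module ((*s) :: 'a::comm_ring_1 \<Rightarrow> 'a ^ 'e::finite \<Rightarrow> 'a ^ 'e)"
  by standard (simp_all add: vec_eq_iff vector_scalar_mult_def algebra_simps)

lemma subspace_Sym_pow:
  "module.subspace poly_scale (Sym_pow n :: ('a::comm_ring_1, 'e::finite) polyring set)"
proof -
  interpret P: module "poly_scale :: 'a \<Rightarrow> ('a, 'e) polyring \<Rightarrow> ('a, 'e) polyring"
    by (rule module_poly_scale)
  have keys_scale: "Poly_Mapping.keys (poly_scale c p) \<subseteq> Poly_Mapping.keys p"
    for c and p :: "('a, 'e) polyring"
  proof
    fix k assume "k \<in> Poly_Mapping.keys (poly_scale c p)"
    then obtain a b where "k = a + b" "a \<in> Poly_Mapping.keys (Poly_Mapping.single (0 :: 'e \<Rightarrow>\<^sub>0 nat) c)"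
      "b \<in> Poly_Mapping.keys p"
      unfolding poly_scale_def using keys_mult by blast
    then show "k \<in> Poly_Mapping.keys p" by (simp split: if_splits)
  qed
  show ?thesis
  proof (rule P.subspaceI)
    show "0 \<in> Sym_pow n" by (simp add: Sym_pow_def)
  next
    fix p q :: "('a, 'e) polyring" assume "p \<in> Sym_pow n" "q \<in> Sym_pow n"
    then show "p + q \<in> Sym_pow n"
      unfolding Sym_pow_def mem_Collect_eq using Poly_Mapping.keys_add[of p q] by (meson Un_iff subsetD)
  next
    fix c and p :: "('a, 'e) polyring" assume "p \<in> Sym_pow n"
    then show "poly_scale c p \<in> Sym_pow n"
      unfolding Sym_pow_def mem_Collect_eq using keys_scale[of c p] by (meson subsetD)
  qed
qed

lemma Rees_pow_subset_Sym_pow: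
  fixes E :: "('a::comm_ring_1 ^ 'e::finite) set"
  shows "Rees_pow E n \<subseteq> Sym_pow n"
proof -
  have lin: "linear_form v \<in> Sym_pow 1" for v :: "'a ^ 'e"
    unfolding linear_form_def
    by (rule module.subspace_sum[OF module_poly_scale subspace_Sym_pow])
      (auto simp: Sym_pow_def lookup_single when_def split: if_splits)
  have mult: "p * q \<in> Sym_pow (i + j)"
    if "p \<in> Sym_pow i" "q \<in> Sym_pow j" for p q :: "('a, 'e) polyring" and i j
    unfolding Sym_pow_def mem_Collect_eq
  proof
    fix k assume "k \<in> Poly_Mapping.keys (p * q)"
    then obtain a b where "k = a + b" "a \<in> Poly_Mapping.keys p" "b \<in> Poly_Mapping.keys q"
      using keys_mult by blast
    with that show "(\<Sum>i\<in>UNIV. Poly_Mapping.lookup k i) = i + j"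
      by (simp add: Sym_pow_def lookup_add sum.distrib)
  qed
  have prod: "(\<Prod>v\<leftarrow>vs. linear_form v) \<in> Sym_pow (length vs)" for vs :: "('a ^ 'e) list"
  proof (induction vs)
    case Nil
    then show ?case by (auto simp: Sym_pow_def)
  next
    case (Cons v vs)
    then show ?case using mult[OF lin] by fastforce
  qed
  show ?thesis
    unfolding Rees_pow_def
    by (rule module.span_minimal[OF module_poly_scale _ subspace_Sym_pow]) (use prod in auto)
qed

end

theory Submission
  imports Defs "HOL-Computational_Algebra.Polynomial"
begin

text \<open>
  Write \<open>Q\<^sub>n = G\<^sub>n / E\<^sub>n\<close>. If \<open>xs\<close> is a \<open>Q\<^sub>n\<close>-regular sequence in \<open>\<mm>\<close> and
  \<open>Q\<^sub>n / xs Q\<^sub>n\<close> has an element \<open>\<noteq> 0\<close> that is killed by \<open>\<mm>\<close>, then the depth of \<open>Q\<^sub>n\<close>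
  is the length of \<open>xs\<close> (\<open>depth_quotient_eq_length\<close>). The proof constructs one sequence that has
  this property for all large \<open>n\<close> simultaneously. It rests on two facts about an ideal
  \<open>I \<subseteq> \<mm>\<close>, to be thought of as generated by the part of the sequence already found.

  First, the socle of \<open>Q\<^sub>n / I Q\<^sub>n\<close> is zero for all large \<open>n\<close> or nonzero for all large \<open>n\<close>
  (\<open>socle_eventually_constant\<close>). If \<open>R / I\<close> contains \<open>z \<noteq> 0\<close> with \<open>\<mm> z = 0\<close>, the socle
  contains the image of \<open>z G\<^sub>n\<close>, which is nonzero for large \<open>n\<close>: the elements of the Rees algebra
  congruent to elements of \<open>z G\<^sub>n\<close> form an ideal, so for large \<open>n\<close> they come from
  \<open>z E G\<^sub>n\<^sub>-\<^sub>1\<close>, while \<open>G\<^sub>n \<noteq> E G\<^sub>n\<^sub>-\<^sub>1 + \<mm> G\<^sub>n\<close> because \<open>E\<close> is proper. Otherwise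
  some \<open>x \<in> \<mm>\<close> is regular on \<open>R / I\<close>. Multiplication by \<open>x\<close> then embeds the module of all
  \<open>v\<close> with \<open>\<mm> v \<subseteq> E\<^sub>n + I G\<^sub>n\<close> for some \<open>n\<close> into the Rees algebra modulo \<open>I\<close>, so this
  module is finitely generated, and a finitely generated module over an algebra generated in degree
  one that vanishes in one large degree vanishes from there on.

  Second, if the socle is zero for all large \<open>n\<close>, one \<open>x \<in> \<mm>\<close> is regular on
  \<open>Q\<^sub>n / I Q\<^sub>n\<close> for all these \<open>n\<close> (\<open>eventually_common_regular_element\<close>). This follows by
  prime avoidance once the associated primes of all \<open>Q\<^sub>n / I Q\<^sub>n\<close> are known to form a finite set.
  They are among those of the associated graded ring, modulo \<open>I\<close>, of the ideal of \<open>R[t]\<close> generated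
  by \<open>E\<close>, since \<open>G\<^sub>n \<supseteq> E G\<^sub>n\<^sub>-\<^sub>1 \<supseteq> E\<^sup>2 G\<^sub>n\<^sub>-\<^sub>2 \<supseteq> \<dots> \<supseteq> E\<^sub>n\<close>.

  Adding regular elements one by one must stop, because the ideals they generate increase strictly; at
  that moment the socle is nonzero for all large \<open>n\<close>.

  All finiteness statements are forms of Hilbert's basis theorem (\<open>noetherian_under_adjoin\<close>), proved
  for a module with commuting operators, so that \<open>R[t]\<close>, the Rees algebra and the associated graded
  ring are covered by the same lemma.
\<close>

section \<open>Noetherian modules with operators\<close>

text \<open>
  A copy of \<open>module\<close>: names declared in \<open>module\<close> itself would be shadowed by its
  unqualified instance for real vector spaces.
\<close>

locale R_module = module scale
  for scale :: "'a::comm_ring_1 \<Rightarrow> 'b::ab_group_add \<Rightarrow> 'b" (infixr "\<odot>" 75)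
begin

definition invariant_subspace :: "('b \<Rightarrow> 'b) set \<Rightarrow> 'b set \<Rightarrow> bool" where
  "invariant_subspace F U \<longleftrightarrow> subspace U \<and> (\<forall>f\<in>F. f ` U \<subseteq> U)"

text \<open>
  The ascending chain condition for the submodules that are stable under a set of operators. With no
  operators these are the \<open>R\<close>-submodules; with multiplications as operators they are the submodules
  over the algebra that the multipliers generate, which therefore needs no type of its own.
\<close>

definition noetherian_under :: "('b \<Rightarrow> 'b) set \<Rightarrow> 'b set \<Rightarrow> bool" where
  "noetherian_under F N \<longleftrightarrow>
     (\<forall>U. (\<forall>n. invariant_subspace F (U n) \<and> U n \<subseteq> N \<and> U n \<subseteq> U (Suc n)) \<longrightarrow>
          (\<exists>k. \<forall>n\<ge>k. U n = U k))"

lemma invariant_subspace_empty [simp]: "invariant_subspace {} U \<longleftrightarrow> subspace U"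
  by (simp add: invariant_subspace_def)

lemma invariant_subspaceD: "invariant_subspace F U \<Longrightarrow> f \<in> F \<Longrightarrow> u \<in> U \<Longrightarrow> f u \<in> U"
  unfolding invariant_subspace_def by blast

lemma noetherian_underD:
  assumes "noetherian_under F N" "\<And>n. invariant_subspace F (U n)" "\<And>n. U n \<subseteq> N"
    "\<And>n. U n \<subseteq> U (Suc n)"
  obtains k where "\<And>n. n \<ge> k \<Longrightarrow> U n = U k"
  using assms unfolding noetherian_under_def by blast

lemma noetherian_under_mono:
  "noetherian_under F N \<Longrightarrow> N' \<subseteq> N \<Longrightarrow> noetherian_under F N'"
  unfolding noetherian_under_def by (meson order_trans)

lemma noetherian_under_maximal:
  assumes N: "noetherian_under F N" and "U0 \<in> \<U>"
    and \<U>: "\<And>U. U \<in> \<U> \<Longrightarrow> invariant_subspace F U \<and> U \<subseteq> N"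
  shows "\<exists>U\<in>\<U>. \<forall>V\<in>\<U>. U \<subseteq> V \<longrightarrow> V = U"
proof (rule ccontr)
  assume "\<not> ?thesis"
  then have step: "\<exists>V. V \<in> \<U> \<and> U \<subset> V" if "U \<in> \<U>" for U
    using that by (metis psubsetI)
  obtain u where u: "\<And>n. u n \<in> \<U>" "\<And>n. u n \<subset> u (Suc n)"
    using dependent_nat_choice[of "\<lambda>_ U. U \<in> \<U>" "\<lambda>_ U V. U \<subset> V"] step \<open>U0 \<in> \<U>\<close> by metis
  obtain k where "\<And>n. n \<ge> k \<Longrightarrow> u n = u k"
    using noetherian_underD[OF N, of u] u \<U> by (metis psubset_imp_subset)
  then show False using u(2)[of k] by (metis le_SucI order_refl psubset_eq)
qed

lemma noetherian_imp_finitely_generated: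
  assumes N: "noetherian_under {} N" and U: "subspace U" "U \<subseteq> N"
  obtains B where "finite B" "B \<subseteq> U" "U = span B"
proof -
  let ?\<U> = "{span B | B. finite B \<and> B \<subseteq> U}"
  have "\<And>V. V \<in> ?\<U> \<Longrightarrow> invariant_subspace {} V \<and> V \<subseteq> N"
    using U span_minimal by auto
  moreover have "span {} \<in> ?\<U>" by blast
  ultimately have "\<exists>V\<in>?\<U>. \<forall>W\<in>?\<U>. V \<subseteq> W \<longrightarrow> W = V"
    by (intro noetherian_under_maximal[OF N, of "span {}" ?\<U>])
  then obtain V where "V \<in> ?\<U>" and V: "\<forall>W\<in>?\<U>. V \<subseteq> W \<longrightarrow> W = V"
    by (rule bexE)
  then obtain B where B: "finite B" "B \<subseteq> U" "V = span B" by blast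
  have "u \<in> span B" if "u \<in> U" for u
  proof -
    have "span (insert u B) \<in> ?\<U>" using B that by blast
    then have "span (insert u B) = V"
      using V span_mono[of B "insert u B"] B(3) by blast
    then show ?thesis using B span_base by blast
  qed
  then have "U = span B" using B U span_minimal by blast
  then show ?thesis using that B by blast
qed

lemma finitely_generated_imp_noetherian:
  assumes "\<And>U. subspace U \<Longrightarrow> U \<subseteq> N \<Longrightarrow> \<exists>B. finite B \<and> U = span B"
  shows "noetherian_under {} N"
  unfolding noetherian_under_def
proof (intro allI impI)
  fix U :: "nat \<Rightarrow> 'b set"
  assume U: "\<forall>n. invariant_subspace {} (U n) \<and> U n \<subseteq> N \<and> U n \<subseteq> U (Suc n)"
  then have mono: "U i \<subseteq> U j" if "i \<le> j" for i j using that by (metis lift_Suc_mono_le)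
  have "subspace (\<Union>n. U n)"
  proof (rule subspaceI)
    show "0 \<in> (\<Union>n. U n)" using U subspace_0 by auto
    show "x + y \<in> (\<Union>n. U n)" if xy: "x \<in> (\<Union>n. U n)" "y \<in> (\<Union>n. U n)" for x y
    proof -
      obtain i j where "x \<in> U i" "y \<in> U j" using xy by blast
      then have "x \<in> U (max i j)" "y \<in> U (max i j)" using mono by (meson max.cobounded1 max.cobounded2 subsetD)+
      then show ?thesis using U subspace_add[of "U (max i j)" x y] by (auto intro!: exI[of _ "max i j"])
    qed
    show "c \<odot> x \<in> (\<Union>n. U n)" if "x \<in> (\<Union>n. U n)" for c x
      using that U subspace_scale by (auto; blast)
  qed
  then obtain B where B: "finite B" "(\<Union>n. U n) = span B"
    using assms[of "\<Union>n. U n"] U by blast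
  have "\<forall>b\<in>B. \<exists>n. b \<in> U n" using B span_superset[of B] by blast
  then obtain g where g: "\<And>b. b \<in> B \<Longrightarrow> b \<in> U (g b)" by metis
  have "B \<subseteq> U (Max (g ` B))"
  proof
    fix b assume b: "b \<in> B"
    then have "U (g b) \<subseteq> U (Max (g ` B))" using B(1) by (intro mono Max_ge) auto
    then show "b \<in> U (Max (g ` B))" using g[OF b] by blast
  qed
  then obtain k where "B \<subseteq> U k" by blast
  then have "(\<Union>n. U n) \<subseteq> U k" using B U by (metis invariant_subspace_empty span_minimal)
  then show "\<exists>k. \<forall>n\<ge>k. U n = U k" using mono by blast
qed

end

interpretation ideal: R_module "(*) :: 'a::comm_ring_1 \<Rightarrow> 'a \<Rightarrow> 'a"
  by standard (simp_all add: algebra_simps)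

(* As a rewrite rule this would be the inverse of mult.assoc. *)
declare ideal.scale_scale [simp del]

context R_module
begin

text \<open>
  A submodule \<open>U\<close> of \<open>N + R v\<close> is determined, inside a larger one, by \<open>U \<inter> N\<close> and by the
  ideal of the coefficients of \<open>v\<close> that occur in \<open>U\<close>.
\<close>

lemma noetherian_span_insert:
  assumes R: "ideal.noetherian_under {} (UNIV :: 'a set)"
    and N: "noetherian_under {} N" and sN: "subspace N"
  shows "noetherian_under {} (span (insert v N))"
  unfolding noetherian_under_def
proof (intro allI impI)
  fix U :: "nat \<Rightarrow> 'b set"
  assume U: "\<forall>n. invariant_subspace {} (U n) \<and> U n \<subseteq> span (insert v N) \<and> U n \<subseteq> U (Suc n)"
  then have sU: "subspace (U n)" for n by simp
  have mono: "U i \<subseteq> U j" if "i \<le> j" for i j using U that by (metis lift_Suc_mono_le)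
  define J where "J n = {r. \<exists>u\<in>N. r \<odot> v + u \<in> U n}" for n
  have sJ: "module.subspace (*) (J n)" for n
  proof (rule ideal.subspaceI)
    show "0 \<in> J n" using subspace_0[OF sU] subspace_0[OF sN] by (auto simp: J_def)
    show "r + r' \<in> J n" if rr: "r \<in> J n" "r' \<in> J n" for r r'
    proof -
      obtain u u' where "u \<in> N" "u' \<in> N" "r \<odot> v + u \<in> U n" "r' \<odot> v + u' \<in> U n"
        using rr unfolding J_def by blast
      then have "u + u' \<in> N" "(r + r') \<odot> v + (u + u') \<in> U n"
        using subspace_add[OF sN] subspace_add[OF sU, of "r \<odot> v + u" n "r' \<odot> v + u'"]
        by (auto simp: scale_left_distrib algebra_simps)
      then show ?thesis by (auto simp: J_def)
    qed
    show "c * r \<in> J n" if rr: "r \<in> J n" for c r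
    proof -
      obtain u where "u \<in> N" "r \<odot> v + u \<in> U n" using rr unfolding J_def by blast
      then have "c \<odot> u \<in> N" "(c * r) \<odot> v + c \<odot> u \<in> U n"
        using subspace_scale[OF sN] subspace_scale[OF sU, of "r \<odot> v + u" n c]
        by (auto simp: scale_right_distrib)
      then show ?thesis by (auto simp: J_def)
    qed
  qed
  obtain k where k: "\<And>n. n \<ge> k \<Longrightarrow> J n = J k"
  proof (rule ideal.noetherian_underD[OF R, of J])
    show "J n \<subseteq> J (Suc n)" for n using U unfolding J_def by blast
  qed (use sJ in auto)
  obtain l where l: "\<And>n. n \<ge> l \<Longrightarrow> U n \<inter> N = U l \<inter> N"
  proof (rule noetherian_underD[OF N, of "\<lambda>n. U n \<inter> N"])
    show "U n \<inter> N \<subseteq> U (Suc n) \<inter> N" for n using U by blast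
  qed (use sU sN subspace_inter in auto)
  let ?K = "max k l"
  have "U n \<subseteq> U ?K" if n: "n \<ge> ?K" for n
  proof
    fix x assume x: "x \<in> U n"
    then have "x \<in> span (insert v N)" using U by blast
    moreover have "span N = N" using sN by simp
    ultimately obtain r where r: "x - r \<odot> v \<in> N" unfolding span_insert by blast
    then have "r \<in> J n" using x unfolding J_def by (auto intro!: bexI[of _ "x - r \<odot> v"])
    then have "r \<in> J ?K" using k n by (metis max.bounded_iff max.cobounded1)
    then obtain u where u: "u \<in> N" "r \<odot> v + u \<in> U ?K" by (auto simp: J_def)
    then have "r \<odot> v + u \<in> U n" using mono[OF n] by blast
    then have "x - (r \<odot> v + u) \<in> U n" using x subspace_diff[OF sU] by blast
    moreover have "x - (r \<odot> v + u) \<in> N" using subspace_diff[OF sN r u(1)] by (simp add: algebra_simps)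
    ultimately have "x - (r \<odot> v + u) \<in> U ?K"
      using l n by (metis IntD1 IntI max.bounded_iff max.cobounded2)
    then show "x \<in> U ?K" using subspace_add[OF sU _ u(2)] by force
  qed
  then show "\<exists>k. \<forall>n\<ge>k. U n = U k" using mono by blast
qed

lemma noetherian_span_finite:
  assumes R: "ideal.noetherian_under {} (UNIV :: 'a set)" and "finite B"
  shows "noetherian_under {} (span B)"
  using \<open>finite B\<close>
proof (induction B)
  case empty
  have "V = {0}" if "subspace V" "V \<subseteq> {0}" for V
    using that subspace_0 by blast
  then show ?case unfolding noetherian_under_def invariant_subspace_empty span_empty by metis
next
  case (insert b B)
  have "span (insert b (span B)) = span (insert b B)"
    by (simp add: span_insert span_span)
  then show ?case using noetherian_span_insert[OF R insert.IH, of b] by simp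
qed

end

text \<open>
  Hilbert's basis theorem, for a module on which a new operator \<open>y\<close> acts. The submodule generated
  by \<open>M\<close> is filtered by degree in \<open>y\<close>, and a submodule of it is determined inside a larger one by
  its leading coefficients: by the submodules of \<open>M\<close> formed by the \<open>m\<close> such that \<open>y\<^sup>d m\<close> plus terms
  of lower degree lies in it.
\<close>

context
  fixes y :: "'b::ab_group_add \<Rightarrow> 'b" and M :: "'b set"
begin

primrec degree_below :: "nat \<Rightarrow> 'b set" where
  "degree_below 0 = {0}"
| "degree_below (Suc d) = {(y ^^ d) m + w | m w. m \<in> M \<and> w \<in> degree_below d}"

definition leading_coeffs :: "'b set \<Rightarrow> nat \<Rightarrow> 'b set" where
  "leading_coeffs N d = {m \<in> M. \<exists>w \<in> degree_below d. (y ^^ d) m + w \<in> N}"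

lemma leading_coeffs_mono: "N \<subseteq> N' \<Longrightarrow> leading_coeffs N d \<subseteq> leading_coeffs N' d"
  by (auto simp: leading_coeffs_def)

end

lemma (in R_module) noetherian_under_adjoin:
  assumes M: "noetherian_under F M" "invariant_subspace F M"
    and y: "module_hom scale scale y" and F: "\<And>f. f \<in> F \<Longrightarrow> module_hom scale scale f"
    and comm: "\<And>f v. f \<in> F \<Longrightarrow> f (y v) = y (f v)"
  shows "\<exists>M'. M \<subseteq> M' \<and> invariant_subspace (insert y F) M' \<and> noetherian_under (insert y F) M'"
proof -
  interpret y: module_hom scale scale y by (rule y)
  let ?D = "degree_below y M" and ?lc = "leading_coeffs y M"
  have sM: "subspace M" and FM: "\<And>f m. f \<in> F \<Longrightarrow> m \<in> M \<Longrightarrow> f m \<in> M"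
    using M(2) by (auto simp: invariant_subspace_def)
  have yn: "module_hom scale scale (y ^^ d)" for d
  proof (induction d)
    case 0
    show ?case unfolding funpow.simps by (rule module_hom_id)
  next
    case (Suc d)
    show ?case unfolding funpow.simps by (rule module_hom_compose[OF Suc y])
  qed
  note yadd = module_hom.add[OF yn] and yscale = module_hom.scale[OF yn] and y0 = module_hom.zero[OF yn]
  have commn: "f ((y ^^ d) v) = (y ^^ d) (f v)" if "f \<in> F" for f d v
    using comm[OF that] by (induction d arbitrary: v) auto
  have DI: "(y ^^ d) m + w \<in> ?D (Suc d)" if "m \<in> M" "w \<in> ?D d" for d m w
    using that by auto
  have sD: "subspace (?D d)" for d
  proof (induction d)
    case (Suc d)
    show ?case
    proof (rule subspaceI)
      show "0 \<in> ?D (Suc d)" using subspace_0[OF sM] subspace_0[OF Suc] y0[of d] by force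
    next
      fix u v assume "u \<in> ?D (Suc d)" "v \<in> ?D (Suc d)"
      then obtain m w m' w' where *: "m \<in> M" "m' \<in> M" "w \<in> ?D d" "w' \<in> ?D d"
        and uv: "u = (y ^^ d) m + w" "v = (y ^^ d) m' + w'" by auto
      have "u + v = (y ^^ d) (m + m') + (w + w')" unfolding uv yadd by (simp add: algebra_simps)
      then show "u + v \<in> ?D (Suc d)" using * subspace_add[OF sM] subspace_add[OF Suc] DI by metis
    next
      fix c v assume "v \<in> ?D (Suc d)"
      then obtain m w where *: "m \<in> M" "w \<in> ?D d" and v: "v = (y ^^ d) m + w" by auto
      have "c \<odot> v = (y ^^ d) (c \<odot> m) + c \<odot> w" unfolding v yscale by (simp add: scale_right_distrib)
      then show "c \<odot> v \<in> ?D (Suc d)" using * subspace_scale[OF sM] subspace_scale[OF Suc] DI by metis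
    qed
  qed simp
  have Dsuc: "?D d \<subseteq> ?D (Suc d)" for d
  proof
    fix w assume "w \<in> ?D d"
    then have "(y ^^ d) 0 + w \<in> ?D (Suc d)" using subspace_0[OF sM] DI by blast
    then show "w \<in> ?D (Suc d)" by (simp add: y0)
  qed
  then have Dmono: "?D d \<subseteq> ?D d'" if "d \<le> d'" for d d' using that by (metis lift_Suc_mono_le)
  have yD: "y w \<in> ?D (Suc d)" if "w \<in> ?D d" for w d
    using that
  proof (induction d arbitrary: w)
    case 0
    then show ?case using subspace_0[OF sM] by auto
  next
    case (Suc d)
    then obtain m w' where "m \<in> M" "w' \<in> ?D d" "w = (y ^^ d) m + w'" by auto
    then have "y w = (y ^^ Suc d) m + y w'" "y w' \<in> ?D (Suc d)" "m \<in> M"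
      using Suc.IH by (auto simp: y.add)
    then show ?case by (metis DI)
  qed
  have FD: "f w \<in> ?D d" if "f \<in> F" "w \<in> ?D d" for f w d
    using that(2)
  proof (induction d arbitrary: w)
    case 0
    then show ?case using module_hom.zero[OF F[OF that(1)]] by simp
  next
    case (Suc d)
    then obtain m w' where *: "m \<in> M" "w' \<in> ?D d" and w: "w = (y ^^ d) m + w'" by auto
    have "f w = (y ^^ d) (f m) + f w'"
      unfolding w by (simp add: module_hom.add[OF F[OF that(1)]] commn[OF that(1)])
    then show ?case using * FM[OF that(1)] Suc.IH DI by metis
  qed
  define M' where "M' = (\<Union>d. ?D d)"
  have sM': "subspace M'"
  proof (rule subspaceI)
    show "0 \<in> M'" using subspace_0[OF sD] by (auto simp: M'_def)
    show "u + v \<in> M'" if uv: "u \<in> M'" "v \<in> M'" for u v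
    proof -
      obtain d d' where "u \<in> ?D d" "v \<in> ?D d'" using uv by (auto simp: M'_def)
      then have "u \<in> ?D (max d d')" "v \<in> ?D (max d d')"
        using Dmono[of d "max d d'"] Dmono[of d' "max d d'"] by auto
      then show ?thesis using subspace_add[OF sD] by (auto simp: M'_def)
    qed
    show "c \<odot> v \<in> M'" if "v \<in> M'" for c v
      using that subspace_scale[OF sD] by (auto simp: M'_def)
  qed
  have inv: "invariant_subspace (insert y F) M'"
    unfolding invariant_subspace_def using sM' yD FD by (auto simp: M'_def; blast)
  have "M \<subseteq> M'"
  proof
    fix m assume "m \<in> M"
    then have "(y ^^ 0) m + 0 \<in> ?D (Suc 0)" by (intro DI) auto
    then show "m \<in> M'" unfolding M'_def by (metis UNIV_I UN_I add.right_neutral funpow_0)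
  qed
  moreover have "noetherian_under (insert y F) M'"
    unfolding noetherian_under_def
  proof (intro allI impI)
    fix U :: "nat \<Rightarrow> 'b set"
    assume U: "\<forall>n. invariant_subspace (insert y F) (U n) \<and> U n \<subseteq> M' \<and> U n \<subseteq> U (Suc n)"
    then have sU: "subspace (U n)" and FU: "f \<in> F \<Longrightarrow> u \<in> U n \<Longrightarrow> f u \<in> U n"
      and yU: "u \<in> U n \<Longrightarrow> y u \<in> U n" for n f u
      unfolding invariant_subspace_def by blast+
    have Umono: "U i \<subseteq> U j" if "i \<le> j" for i j using U that by (metis lift_Suc_mono_le)
    have lc_inv: "invariant_subspace F (?lc (U n) d)" for n d
      unfolding invariant_subspace_def
    proof (intro conjI ballI subspaceI)
      show "0 \<in> ?lc (U n) d"
        using subspace_0[OF sM] subspace_0[OF sD] subspace_0[OF sU] y0 by (force simp: leading_coeffs_def)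
    next
      fix a b assume "a \<in> ?lc (U n) d" "b \<in> ?lc (U n) d"
      then obtain w w' where *: "a \<in> M" "b \<in> M" "w \<in> ?D d" "w' \<in> ?D d"
        "(y ^^ d) a + w \<in> U n" "(y ^^ d) b + w' \<in> U n" by (auto simp: leading_coeffs_def)
      have "(y ^^ d) (a + b) + (w + w') \<in> U n"
        using subspace_add[OF sU *(5,6)] by (simp add: yadd algebra_simps)
      then show "a + b \<in> ?lc (U n) d"
        using * subspace_add[OF sM] subspace_add[OF sD] unfolding leading_coeffs_def by blast
    next
      fix c a assume "a \<in> ?lc (U n) d"
      then obtain w where *: "a \<in> M" "w \<in> ?D d" "(y ^^ d) a + w \<in> U n" by (auto simp: leading_coeffs_def)
      have "(y ^^ d) (c \<odot> a) + c \<odot> w \<in> U n"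
        using subspace_scale[OF sU *(3)] by (simp add: yscale scale_right_distrib)
      then show "c \<odot> a \<in> ?lc (U n) d"
        using * subspace_scale[OF sM] subspace_scale[OF sD] unfolding leading_coeffs_def by blast
    next
      fix f assume f: "f \<in> F"
      show "f ` ?lc (U n) d \<subseteq> ?lc (U n) d"
      proof
        fix b assume "b \<in> f ` ?lc (U n) d"
        then obtain a w where *: "a \<in> M" "w \<in> ?D d" "(y ^^ d) a + w \<in> U n" "b = f a"
          by (auto simp: leading_coeffs_def)
        have "(y ^^ d) (f a) + f w \<in> U n"
          using FU[OF f *(3)] by (simp add: module_hom.add[OF F[OF f]] commn[OF f])
        then show "b \<in> ?lc (U n) d"
          using * FM[OF f] FD[OF f] unfolding leading_coeffs_def by blast
      qed
    qed
    have lc_suc: "?lc (U n) d \<subseteq> ?lc (U n) (Suc d)" for n d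
    proof
      fix a assume "a \<in> ?lc (U n) d"
      then obtain w where *: "a \<in> M" "w \<in> ?D d" "(y ^^ d) a + w \<in> U n" by (auto simp: leading_coeffs_def)
      have "(y ^^ Suc d) a + y w \<in> U n" using yU[OF *(3)] by (simp add: y.add)
      then show "a \<in> ?lc (U n) (Suc d)" using * yD unfolding leading_coeffs_def by blast
    qed
    have lc_mono: "?lc (U i) d \<subseteq> ?lc (U j) d'" if "i \<le> j" "d \<le> d'" for i j d d'
      using leading_coeffs_mono[OF Umono[OF that(1)]] lift_Suc_mono_le[of "?lc (U j)", OF lc_suc that(2)]
      by (meson order_trans)
    have lcM: "?lc N d \<subseteq> M" for N d by (auto simp: leading_coeffs_def)
    (* The diagonal chain bounds the degrees in which leading coefficients can still grow; below that
       bound there are finitely many chains to wait for. *)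
    obtain k where k: "\<And>n. n \<ge> k \<Longrightarrow> ?lc (U n) n = ?lc (U k) k"
      using noetherian_underD[OF M(1), of "\<lambda>n. ?lc (U n) n"] lc_inv lcM lc_mono
      by (metis le_SucI order_refl)
    have large: "?lc (U n) d = ?lc (U k) k" if "n \<ge> k" "d \<ge> k" for n d
      using lc_mono[of n "max n d" d "max n d"] lc_mono[of k n k d] k[of "max n d"] that by auto
    have "\<exists>l. \<forall>n\<ge>l. ?lc (U n) d = ?lc (U l) d" for d
      using noetherian_underD[OF M(1), of "\<lambda>n. ?lc (U n) d"] lc_inv lcM lc_mono
      by (metis le_SucI order_refl)
    then obtain l where l: "\<And>d n. n \<ge> l d \<Longrightarrow> ?lc (U n) d = ?lc (U (l d)) d" by metis
    define K where "K = max k (Max (l ` {..k}))"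
    have lK: "l d \<le> K" if "d \<le> k" for d
      unfolding K_def using that by (intro max.coboundedI2 Max_ge) auto
    have eq: "?lc (U n) d = ?lc (U K) d" if "n \<ge> K" for n d
    proof (cases "d \<le> k")
      case True
      then show ?thesis using l[of d n] l[of d K] lK[of d] that by auto
    next
      case False
      then show ?thesis using large[of n d] large[of K d] that by (auto simp: K_def)
    qed
    have "v \<in> U K" if n: "n \<ge> K" and v: "v \<in> U n" "v \<in> ?D d" for n v d
      using v
    proof (induction d arbitrary: v)
      case 0
      then show ?case using subspace_0[OF sU] by simp
    next
      case (Suc d)
      then obtain m w where *: "m \<in> M" "w \<in> ?D d" "v = (y ^^ d) m + w" by auto
      then have "m \<in> ?lc (U n) d" using Suc.prems by (auto simp: leading_coeffs_def)
      then have "m \<in> ?lc (U K) d" using eq[OF n] by blast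
      then obtain w' where w': "w' \<in> ?D d" "(y ^^ d) m + w' \<in> U K"
        by (auto simp: leading_coeffs_def)
      have "w - w' = v - ((y ^^ d) m + w')" using * by simp
      also have "\<dots> \<in> U n" using Suc.prems w' Umono[OF n] subspace_diff[OF sU] by blast
      finally have "w - w' \<in> U K" using Suc.IH subspace_diff[OF sD *(2) w'(1)] by blast
      then have "(w - w') + ((y ^^ d) m + w') \<in> U K" using w'(2) subspace_add[OF sU] by blast
      then show ?case using * by (simp add: algebra_simps)
    qed
    moreover have "U n \<subseteq> (\<Union>d. ?D d)" for n using U unfolding M'_def by blast
    ultimately have "U n \<subseteq> U K" if "n \<ge> K" for n using that by blast
    then show "\<exists>k. \<forall>n\<ge>k. U n = U k" using Umono by blast
  qed
  ultimately show ?thesis using inv by blast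
qed

lemma (in R_module) noetherian_under_finite_operators:
  assumes "finite F"
    and F: "\<And>f. f \<in> F \<Longrightarrow> module_hom scale scale f"
    and comm: "\<And>f g v. f \<in> F \<Longrightarrow> g \<in> F \<Longrightarrow> f (g v) = g (f v)"
    and M: "noetherian_under {} M" "subspace M"
  shows "\<exists>M'. M \<subseteq> M' \<and> invariant_subspace F M' \<and> noetherian_under F M'"
  using assms(1-3)
proof (induction F)
  case empty
  then show ?case using M by auto
next
  case (insert y F)
  then obtain M' where "M \<subseteq> M'" "invariant_subspace F M'" "noetherian_under F M'" by auto
  moreover obtain M'' where "M' \<subseteq> M''" "invariant_subspace (insert y F) M''"
    "noetherian_under (insert y F) M''"
    using noetherian_under_adjoin[of F M' y] calculation insert.prems by auto
  ultimately show ?case by (metis order_trans)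
qed

section \<open>Associated primes and prime avoidance\<close>

definition prime_ideal :: "'a::comm_ring_1 set \<Rightarrow> bool" where
  "prime_ideal p \<longleftrightarrow> module.subspace (*) p \<and> p \<noteq> UNIV \<and> (\<forall>a b. a * b \<in> p \<longrightarrow> a \<in> p \<or> b \<in> p)"

context R_module
begin

definition annihilator :: "'b set \<Rightarrow> 'b \<Rightarrow> 'a set" where
  "annihilator L v = {a. a \<odot> v \<in> L}"

lemma ideal_annihilator:
  assumes "subspace L"
  shows "module.subspace (*) (annihilator L v)"
proof (rule ideal.subspaceI)
  show "c * a \<in> annihilator L v" if "a \<in> annihilator L v" for c a
    using that subspace_scale[OF assms, of "a \<odot> v" c] by (simp add: annihilator_def)
qed (use assms in \<open>auto simp: annihilator_def scale_left_distrib subspace_0 subspace_add\<close>)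

lemma annihilator_scale:
  assumes "subspace L"
  shows "annihilator L v \<subseteq> annihilator L (r \<odot> v)"
proof
  fix a assume "a \<in> annihilator L v"
  then have "r \<odot> (a \<odot> v) \<in> L" using subspace_scale[OF assms] by (simp only: annihilator_def mem_Collect_eq)
  then show "a \<in> annihilator L (r \<odot> v)"
    unfolding annihilator_def mem_Collect_eq by (simp only: scale_left_commute[of a r])
qed

text \<open>
  A submodule \<open>K\<close> is enlarged to \<open>{v. p v \<subseteq> K}\<close>, where \<open>p\<close> is maximal among the annihilators
  of elements outside \<open>K\<close>; this \<open>p\<close> is prime and is the annihilator modulo \<open>K\<close> of every new
  element. The process stops since \<open>N\<close> is Noetherian under the operators, and the primes met on the
  way suffice.
\<close>

lemma finite_associated_primes:
  assumes R: "ideal.noetherian_under {} (UNIV :: 'a set)"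
    and N: "noetherian_under F N" "invariant_subspace F N"
    and L: "invariant_subspace F L" "L \<subseteq> N"
    and F: "\<And>f. f \<in> F \<Longrightarrow> module_hom scale scale f"
  shows "\<exists>P. finite P \<and> (\<forall>p\<in>P. prime_ideal p) \<and>
           (\<forall>v\<in>N - L. \<exists>r. r \<odot> v \<notin> L \<and> annihilator L (r \<odot> v) \<in> P)"
proof -
  define good where "good K \<longleftrightarrow> (\<exists>P. finite P \<and> (\<forall>p\<in>P. prime_ideal p) \<and>
           (\<forall>v\<in>K - L. \<exists>r. r \<odot> v \<notin> L \<and> annihilator L (r \<odot> v) \<in> P))" for K
  let ?\<U> = "{K. invariant_subspace F K \<and> L \<subseteq> K \<and> K \<subseteq> N \<and> good K}"
  have sN: "subspace N" using N(2) by (simp add: invariant_subspace_def)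
  have "good L" unfolding good_def by (rule exI[of _ "{}"]) auto
  then have "L \<in> ?\<U>" using L by simp
  then have "\<exists>K\<in>?\<U>. \<forall>V\<in>?\<U>. K \<subseteq> V \<longrightarrow> V = K"
    by (rule noetherian_under_maximal[OF N(1)]) auto
  then obtain K where "K \<in> ?\<U>" and Kmax: "\<forall>V\<in>?\<U>. K \<subseteq> V \<longrightarrow> V = K" by (rule bexE)
  then have K: "invariant_subspace F K" "L \<subseteq> K" "K \<subseteq> N" "good K" and sK: "subspace K"
    by (auto simp: invariant_subspace_def)
  have "K = N"
  proof (rule ccontr)
    assume "K \<noteq> N"
    then obtain v0 where v0: "v0 \<in> N - K" using K by blast
    let ?A = "annihilator K ` (N - K)"
    have "\<exists>p\<in>?A. \<forall>q\<in>?A. p \<subseteq> q \<longrightarrow> q = p"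
      by (rule ideal.noetherian_under_maximal[OF R, of "annihilator K v0"])
        (use v0 ideal_annihilator[OF sK] in auto)
    then obtain p where "p \<in> ?A" and pmax: "\<forall>q\<in>?A. p \<subseteq> q \<longrightarrow> q = p" by (rule bexE)
    then obtain v where v: "v \<in> N" "v \<notin> K" and p: "p = annihilator K v" by blast
    have "prime_ideal p"
      unfolding prime_ideal_def
    proof (intro conjI allI impI)
      show "module.subspace (*) p" unfolding p by (rule ideal_annihilator[OF sK])
      have "1 \<notin> p" using v by (simp add: p annihilator_def)
      then show "p \<noteq> UNIV" by blast
      show "a \<in> p \<or> b \<in> p" if ab: "a * b \<in> p" for a b
      proof (rule disjCI)
        assume b: "b \<notin> p"
        then have "b \<odot> v \<in> N - K" using v subspace_scale[OF sN] by (simp add: p annihilator_def)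
        then have "annihilator K (b \<odot> v) = p"
          using pmax annihilator_scale[OF sK, of v b] p by blast
        moreover have "a \<in> annihilator K (b \<odot> v)" using ab by (simp add: p annihilator_def)
        ultimately show "a \<in> p" by simp
      qed
    qed
    define K' where "K' = {u \<in> N. \<forall>a\<in>p. a \<odot> u \<in> K}"
    have sK': "subspace K'"
      by (rule subspaceI)
        (auto simp: K'_def subspace_0[OF sN] subspace_0[OF sK] scale_right_distrib
          subspace_add[OF sN] subspace_add[OF sK] subspace_scale[OF sN] subspace_scale[OF sK] scale_left_commute
          simp del: scale_scale)
    have "f ` K' \<subseteq> K'" if f: "f \<in> F" for f
    proof
      fix w assume "w \<in> f ` K'"
      then obtain u where u: "u \<in> N" "\<forall>a\<in>p. a \<odot> u \<in> K" and w: "w = f u" by (auto simp: K'_def)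
      have "f u \<in> N" using u f N(2) by (auto simp: invariant_subspace_def)
      moreover have "a \<odot> f u \<in> K" if "a \<in> p" for a
        using u(2) that f K(1) module_hom.scale[OF F[OF f], of a u]
        by (metis image_subset_iff invariant_subspace_def)
      ultimately show "w \<in> K'" by (simp add: K'_def w)
    qed
    then have "invariant_subspace F K'" using sK' by (simp add: invariant_subspace_def)
    moreover have KK': "K \<subseteq> K'" using K(3) subspace_scale[OF sK] by (auto simp: K'_def)
    moreover have "good K'"
    proof -
      obtain P where P: "finite P" "\<forall>p\<in>P. prime_ideal p"
        "\<And>v. v \<in> K - L \<Longrightarrow> \<exists>r. r \<odot> v \<notin> L \<and> annihilator L (r \<odot> v) \<in> P"
        using K(4) unfolding good_def by blast
      have "\<exists>r. r \<odot> u \<notin> L \<and> annihilator L (r \<odot> u) \<in> insert p P" if u: "u \<in> K' - L" for u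
      proof (cases "\<exists>r. r \<odot> u \<in> K - L")
        case True
        then obtain r where "r \<odot> u \<in> K - L" by blast
        from P(3)[OF this] obtain r' where "(r' * r) \<odot> u \<notin> L" "annihilator L ((r' * r) \<odot> u) \<in> P"
          by auto
        then show ?thesis by blast
      next
        case False
        then have "u \<notin> K" using u by (metis DiffD2 DiffI scale_one)
        have "annihilator L u = annihilator K u" using False K(2) by (auto simp: annihilator_def)
        also have "\<dots> = p"
          using pmax u \<open>u \<notin> K\<close> by (auto simp: K'_def annihilator_def)
        finally show ?thesis using u by (intro exI[of _ 1]) auto
      qed
      then show ?thesis
        unfolding good_def using P \<open>prime_ideal p\<close> by (intro exI[of _ "insert p P"]) auto
    qed
    ultimately have "K' \<in> ?\<U>" using K(2) by (auto simp: K'_def)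
    then have "K' = K" using Kmax KK' by blast
    moreover have "v \<in> K'" using v by (auto simp: K'_def p annihilator_def)
    ultimately show False using v by blast
  qed
  then show ?thesis using K(4) unfolding good_def by blast
qed

end

lemma one_notin_proper_ideal:
  fixes J :: "'a::comm_ring_1 set"
  assumes J: "module.subspace (*) J" "J \<noteq> UNIV"
  shows "1 \<notin> J"
proof
  assume "1 \<in> J"
  then have "c \<in> J" for c using ideal.subspace_scale[OF J(1), of 1 c] by simp
  then show False using J(2) by blast
qed

text \<open>
  To also avoid \<open>p\<close>, forget the primes contained in \<open>p\<close>: an element outside \<open>p\<close> avoids them
  anyway. If the element found for the remaining primes lies in \<open>p\<close>, it is corrected by an element
  of \<open>J\<close> that lies in each of them but not in \<open>p\<close>.
\<close>

lemma prime_avoidance: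
  fixes J :: "'a::comm_ring_1 set"
  assumes "finite P" and "\<And>p. p \<in> P \<Longrightarrow> prime_ideal p \<and> \<not> J \<subseteq> p" and J: "module.subspace (*) J"
  shows "\<exists>x\<in>J. \<forall>p\<in>P. x \<notin> p"
  using assms(1,2)
proof (induction P rule: finite_psubset_induct)
  case (psubset P)
  show ?case
  proof (cases "P = {}")
    case True
    then show ?thesis using ideal.subspace_0[OF J] by blast
  next
    case False
    then obtain p where p: "p \<in> P" by blast
    define P' where "P' = {q \<in> P. \<not> q \<subseteq> p}"
    have "P' \<subset> P" using p by (auto simp: P'_def)
    then obtain x where x: "x \<in> J" "\<forall>q\<in>P'. x \<notin> q" using psubset by (metis psubset_imp_subset subsetD)
    show ?thesis
    proof (cases "x \<in> p")
      case False
      then show ?thesis using x by (auto simp: P'_def)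
    next
      case True
      have sub: "module.subspace (*) q" "a * b \<in> q \<Longrightarrow> a \<in> q \<or> b \<in> q" "1 \<notin> q" if "q \<in> P" for q a b
        using psubset.prems[OF that] one_notin_proper_ideal[of q]
        by (auto simp: prime_ideal_def)
      obtain j where j: "j \<in> J" "j \<notin> p" using psubset.prems[OF p] by blast
      have "\<forall>q\<in>P'. \<exists>z. z \<in> q \<and> z \<notin> p" by (auto simp: P'_def)
      then obtain z where z: "\<And>q. q \<in> P' \<Longrightarrow> z q \<in> q \<and> z q \<notin> p" by metis
      have "finite P'" using psubset.hyps by (simp add: P'_def)
      have "(\<Prod>q\<in>Q. z q) \<notin> p" if "Q \<subseteq> P'" for Q
        using finite_subset[OF that \<open>finite P'\<close>] that
        by (induction Q) (use sub[OF p] z in auto)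
      then have y: "j * (\<Prod>q\<in>P'. z q) \<notin> p" using j sub[OF p] by blast
      have yq: "j * (\<Prod>q\<in>P'. z q) \<in> q" if q: "q \<in> P'" for q
      proof -
        have "j * (\<Prod>q\<in>P'. z q) = (j * (\<Prod>q\<in>P' - {q}. z q)) * z q"
          unfolding prod.remove[OF \<open>finite P'\<close> q, of z] by (simp only: ac_simps)
        moreover have "q \<in> P" using q by (simp add: P'_def)
        ultimately show ?thesis using ideal.subspace_scale[OF sub(1)] z q by metis
      qed
      let ?w = "x + j * (\<Prod>q\<in>P'. z q)"
      have "?w \<in> J"
        using ideal.subspace_add[OF J x(1)] ideal.subspace_scale[OF J j(1), of "\<Prod>q\<in>P'. z q"]
        by (simp add: mult.commute)
      moreover have "?w \<notin> p"
        using ideal.subspace_diff[OF sub(1)[OF p], of ?w x] True y by auto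
      moreover have "?w \<notin> q" if q: "q \<in> P'" for q
        using ideal.subspace_diff[OF sub(1)[of q], of ?w "j * (\<Prod>q\<in>P'. z q)"] yq[OF q] x q
        by (auto simp: P'_def)
      ultimately show ?thesis unfolding P'_def by blast
    qed
  qed
qed

section \<open>Noetherian local rings\<close>

lemma noetherian_local_ring_ideals:
  fixes \<mm> :: "'a::comm_ring_1 set"
  assumes "noetherian_local_ring \<mm>"
  shows "ideal.noetherian_under {} (UNIV :: 'a set)"
proof (rule ideal.finitely_generated_imp_noetherian)
  show "\<exists>B. finite B \<and> I = module.span (*) B" if "module.subspace (*) I" for I :: "'a set"
    using assms that unfolding noetherian_local_ring_def by simp
qed

locale noetherian_local_module = R_module scale
  for scale :: "'a::comm_ring_1 \<Rightarrow> 'b::ab_group_add \<Rightarrow> 'b" (infixr "\<odot>" 75) +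
  fixes \<mm> :: "'a set"
  assumes local: "noetherian_local_ring \<mm>"
begin

lemmas ideals_noetherian = noetherian_local_ring_ideals[OF local]

lemma ideal_\<mm>: "module.subspace (*) \<mm>" and \<mm>_proper: "\<mm> \<noteq> UNIV"
  and \<mm>_maximal: "module.subspace (*) J \<Longrightarrow> \<mm> \<subseteq> J \<Longrightarrow> J = \<mm> \<or> J = UNIV"
proof -
  have "maximal_ideal \<mm>" using local by (simp add: noetherian_local_ring_def)
  then show "module.subspace (*) \<mm>" "\<mm> \<noteq> UNIV"
    "module.subspace (*) J \<Longrightarrow> \<mm> \<subseteq> J \<Longrightarrow> J = \<mm> \<or> J = UNIV"
    by (simp_all add: maximal_ideal_def)
qed

lemma one_notin_\<mm>: "1 \<notin> \<mm>"
  using one_notin_proper_ideal[OF ideal_\<mm> \<mm>_proper] .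

lemma unit_of_notin_\<mm>:
  assumes "a \<notin> \<mm>"
  shows "\<exists>b. b * a = 1"
proof (rule ccontr)
  assume no: "\<not> ?thesis"
  let ?J = "module.span (*) {a}"
  let ?\<U> = "{J. module.subspace (*) J \<and> a \<in> J \<and> J \<noteq> UNIV}"
  have "1 \<notin> ?J" using no by (auto simp: ideal.span_singleton)
  then have "?J \<in> ?\<U>" using ideal.span_base by auto
  then have "\<exists>J\<in>?\<U>. \<forall>V\<in>?\<U>. J \<subseteq> V \<longrightarrow> V = J"
    by (rule ideal.noetherian_under_maximal[OF ideals_noetherian]) auto
  then obtain J where "J \<in> ?\<U>" and J: "\<forall>V\<in>?\<U>. J \<subseteq> V \<longrightarrow> V = J" by (rule bexE)
  then have "maximal_ideal J" unfolding maximal_ideal_def by blast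
  then have "J = \<mm>" using local unfolding noetherian_local_ring_def by blast
  then show False using \<open>J \<in> ?\<U>\<close> assms by blast
qed

lemma unit_one_minus:
  assumes "x \<in> \<mm>"
  shows "\<exists>b. b * (1 - r * x) = 1"
proof (rule unit_of_notin_\<mm>)
  show "1 - r * x \<notin> \<mm>"
  proof
    assume "1 - r * x \<in> \<mm>"
    then have "1 - r * x + r * x \<in> \<mm>"
      by (rule ideal.subspace_add[OF ideal_\<mm> _ ideal.subspace_scale[OF ideal_\<mm> assms]])
    then show False using one_notin_\<mm> by simp
  qed
qed

lemma \<mm>_prime: "prime_ideal \<mm>"
  unfolding prime_ideal_def
proof (intro conjI allI impI disjCI)
  fix a b assume ab: "a * b \<in> \<mm>" and "b \<notin> \<mm>"
  then obtain c where "c * b = 1" using unit_of_notin_\<mm> by blast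
  then have "c * (a * b) = a" by (metis mult.left_commute mult.right_neutral)
  then show "a \<in> \<mm>" using ideal.subspace_scale[OF ideal_\<mm> ab, of c] by simp
qed (use ideal_\<mm> \<mm>_proper in auto)

text \<open>Nakayama's lemma for a principal ideal, by means of a maximal proper submodule.\<close>

lemma nakayama:
  assumes K: "noetherian_under {} K" "subspace K" and L: "subspace L" "L \<subseteq> K"
    and x: "x \<in> \<mm>" and KxK: "\<And>v. v \<in> K \<Longrightarrow> \<exists>w\<in>K. v - x \<odot> w \<in> L"
  shows "K = L"
proof (rule ccontr)
  assume "K \<noteq> L"
  let ?\<U> = "{V. subspace V \<and> L \<subseteq> V \<and> V \<subset> K}"
  have "L \<in> ?\<U>" using L \<open>K \<noteq> L\<close> by auto
  then have "\<exists>V\<in>?\<U>. \<forall>W\<in>?\<U>. V \<subseteq> W \<longrightarrow> W = V"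
    by (rule noetherian_under_maximal[OF K(1)]) auto
  then obtain V where "V \<in> ?\<U>" and max: "\<forall>W\<in>?\<U>. V \<subseteq> W \<longrightarrow> W = V" by (rule bexE)
  then have V: "subspace V" "L \<subseteq> V" "V \<subset> K" by auto
  have xV: "x \<odot> w \<in> V" if w: "w \<in> K" for w
  proof (rule ccontr)
    assume xw: "x \<odot> w \<notin> V"
    have ins: "span (insert (x \<odot> w) V) \<subseteq> K"
      using V w K(2) by (intro span_minimal) (auto simp: subspace_scale)
    have "span (insert (x \<odot> w) V) \<notin> ?\<U> \<or> span (insert (x \<odot> w) V) = V"
      using max span_superset[of "insert (x \<odot> w) V"] by blast
    then have "span (insert (x \<odot> w) V) = K"
      using ins xw span_superset[of "insert (x \<odot> w) V"] V(2) by auto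
    moreover have "span V = V" using V(1) by simp
    ultimately obtain r where "w - r \<odot> x \<odot> w \<in> V" using w unfolding span_insert by blast
    then have "(1 - r * x) \<odot> w \<in> V" by (simp add: scale_left_diff_distrib)
    moreover obtain b where "b * (1 - r * x) = 1" using unit_one_minus[OF x] by blast
    ultimately have "w \<in> V" using subspace_scale[OF V(1), of "(1 - r * x) \<odot> w" b] by simp
    then show False using xw subspace_scale[OF V(1)] by blast
  qed
  have "K \<subseteq> V"
  proof
    fix v assume "v \<in> K"
    then obtain w where "w \<in> K" "v - x \<odot> w \<in> V" using KxK V(2) by blast
    then show "v \<in> V" using subspace_add[OF V(1) _ xV, of "v - x \<odot> w" w] by simp
  qed
  then show False using V(3) by blast
qed

end

section \<open>Depth is the length of any maximal regular sequence\<close>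

context R_module
begin

definition regular_on :: "'b set \<Rightarrow> 'b set \<Rightarrow> 'a \<Rightarrow> bool" where
  "regular_on N L x \<longleftrightarrow> (\<forall>v\<in>N. x \<odot> v \<in> L \<longrightarrow> v \<in> L)"

definition weakly_regular :: "'b set \<Rightarrow> 'b set \<Rightarrow> 'a list \<Rightarrow> bool" where
  "weakly_regular N L xs \<longleftrightarrow>
     (\<forall>i<length xs. regular_on N (ideal_mult scale N L (take i xs)) (xs ! i))"

lemma regular_sequence_iff:
  "regular_sequence scale N L xs \<longleftrightarrow> weakly_regular N L xs \<and> ideal_mult scale N L xs \<noteq> N"
  by (simp add: regular_sequence_def weakly_regular_def regular_on_def)

lemma subspace_ideal_mult [simp]: "subspace (ideal_mult scale N L xs)"
  by (simp add: ideal_mult_def)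

lemma ideal_mult_superset: "L \<subseteq> ideal_mult scale N L xs"
  unfolding ideal_mult_def using span_superset by blast

lemma ideal_mult_subset:
  assumes "subspace N" "L \<subseteq> N"
  shows "ideal_mult scale N L xs \<subseteq> N"
  unfolding ideal_mult_def using assms by (intro span_minimal) (auto simp: subspace_scale)

lemma ideal_mult_Nil [simp]: "subspace L \<Longrightarrow> ideal_mult scale N L [] = L"
  by (simp add: ideal_mult_def)

lemma ideal_mult_cong: "set xs = set ys \<Longrightarrow> ideal_mult scale N L xs = ideal_mult scale N L ys"
  by (simp add: ideal_mult_def)

lemma ideal_mult_append:
  "ideal_mult scale N (ideal_mult scale N L xs) ys = ideal_mult scale N L (xs @ ys)"
proof
  show "ideal_mult scale N (ideal_mult scale N L xs) ys \<subseteq> ideal_mult scale N L (xs @ ys)"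
    unfolding ideal_mult_def[of scale N "ideal_mult scale N L xs"]
  proof (rule span_minimal)
    have "ideal_mult scale N L xs \<subseteq> ideal_mult scale N L (xs @ ys)"
      unfolding ideal_mult_def by (intro span_mono) auto
    moreover have "{x \<odot> v |x v. x \<in> set ys \<and> v \<in> N} \<subseteq> ideal_mult scale N L (xs @ ys)"
      unfolding ideal_mult_def by (rule order_trans[OF _ span_superset]) auto
    ultimately show "ideal_mult scale N L xs \<union> {x \<odot> v |x v. x \<in> set ys \<and> v \<in> N}
        \<subseteq> ideal_mult scale N L (xs @ ys)" by blast
  qed simp
  have "L \<union> {x \<odot> v |x v. x \<in> set xs \<and> v \<in> N} \<subseteq> ideal_mult scale N L xs"
    unfolding ideal_mult_def by (rule span_superset)
  moreover have "ideal_mult scale N L xs \<union> {x \<odot> v |x v. x \<in> set ys \<and> v \<in> N}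
      \<subseteq> ideal_mult scale N (ideal_mult scale N L xs) ys"
    unfolding ideal_mult_def[of scale N "ideal_mult scale N L xs"] by (rule span_superset)
  ultimately have "L \<union> {x \<odot> v |x v. x \<in> set (xs @ ys) \<and> v \<in> N}
      \<subseteq> ideal_mult scale N (ideal_mult scale N L xs) ys"
    unfolding set_append by blast
  then show "ideal_mult scale N L (xs @ ys) \<subseteq> ideal_mult scale N (ideal_mult scale N L xs) ys"
    unfolding ideal_mult_def[of scale N L "xs @ ys"] by (intro span_minimal) auto
qed

lemma mem_ideal_mult_singleton:
  assumes N: "subspace N" and L: "subspace L"
  shows "w \<in> ideal_mult scale N L [x] \<longleftrightarrow> (\<exists>u\<in>N. w - x \<odot> u \<in> L)"
proof
  let ?T = "{w. \<exists>u\<in>N. w - x \<odot> u \<in> L}"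
  have "subspace ?T"
  proof (rule subspaceI)
    show "0 \<in> ?T" using subspace_0[OF N] subspace_0[OF L] by force
  next
    fix a b assume "a \<in> ?T" "b \<in> ?T"
    then obtain u v where "u \<in> N" "v \<in> N" "a - x \<odot> u \<in> L" "b - x \<odot> v \<in> L" by blast
    then have "u + v \<in> N" "a + b - x \<odot> (u + v) \<in> L"
      using subspace_add[OF N] subspace_add[OF L, of "a - x \<odot> u" "b - x \<odot> v"]
      by (simp_all add: scale_right_distrib algebra_simps)
    then show "a + b \<in> ?T" by blast
  next
    fix c a assume "a \<in> ?T"
    then obtain u where "u \<in> N" "a - x \<odot> u \<in> L" by blast
    then have "c \<odot> u \<in> N" "c \<odot> a - x \<odot> (c \<odot> u) \<in> L"
      using subspace_scale[OF N] subspace_scale[OF L, of "a - x \<odot> u" c]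
      by (simp_all add: scale_right_diff_distrib mult.commute)
    then show "c \<odot> a \<in> ?T" by blast
  qed
  moreover have "L \<subseteq> ?T" using subspace_0[OF N] by force
  moreover have "{y \<odot> v |y v. y \<in> set [x] \<and> v \<in> N} \<subseteq> ?T" using subspace_0[OF L] by force
  ultimately have "ideal_mult scale N L [x] \<subseteq> ?T"
    unfolding ideal_mult_def by (intro span_minimal) auto
  then show "\<exists>u\<in>N. w - x \<odot> u \<in> L" if "w \<in> ideal_mult scale N L [x]" using that by blast
next
  assume "\<exists>u\<in>N. w - x \<odot> u \<in> L"
  then obtain u where u: "u \<in> N" "w - x \<odot> u \<in> L" by blast
  have "w - x \<odot> u \<in> ideal_mult scale N L [x]" using u(2) ideal_mult_superset by blast
  moreover have "x \<odot> u \<in> ideal_mult scale N L [x]"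
    unfolding ideal_mult_def using u(1) by (intro span_base) auto
  ultimately show "w \<in> ideal_mult scale N L [x]"
    using subspace_add[OF subspace_ideal_mult, of "w - x \<odot> u" N L "[x]" "x \<odot> u"] by simp
qed

lemma weakly_regular_Nil [simp]: "weakly_regular N L []"
  by (simp add: weakly_regular_def)

lemma weakly_regular_snoc:
  "weakly_regular N L (xs @ [x]) \<longleftrightarrow>
     weakly_regular N L xs \<and> regular_on N (ideal_mult scale N L xs) x"
  by (auto simp: weakly_regular_def nth_append less_Suc_eq)

lemma weakly_regular_Cons:
  assumes "subspace L"
  shows "weakly_regular N L (x # xs) \<longleftrightarrow>
     regular_on N L x \<and> weakly_regular N (ideal_mult scale N L [x]) xs"
proof -
  have "weakly_regular N L (x # xs) \<longleftrightarrow>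
      (\<forall>i<Suc (length xs). regular_on N (ideal_mult scale N L (take i (x # xs))) ((x # xs) ! i))"
    by (simp add: weakly_regular_def)
  then show ?thesis
    unfolding All_less_Suc2 weakly_regular_def by (simp add: ideal_mult_append assms)
qed

lemma weakly_regular_take: "weakly_regular N L xs \<Longrightarrow> weakly_regular N L (take k xs)"
  by (simp add: weakly_regular_def min_def)

end

context noetherian_local_module
begin

definition has_nonzero_socle :: "'b set \<Rightarrow> 'b set \<Rightarrow> bool" where
  "has_nonzero_socle N L \<longleftrightarrow> (\<exists>v\<in>N - L. \<forall>a\<in>\<mm>. a \<odot> v \<in> L)"

lemma not_has_nonzero_socle_regular:
  "regular_on N L x \<Longrightarrow> x \<in> \<mm> \<Longrightarrow> \<not> has_nonzero_socle N L"
  by (auto simp: has_nonzero_socle_def regular_on_def)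

lemma avoid_all_but_\<mm>:
  assumes "finite P" "\<And>p. p \<in> P \<Longrightarrow> prime_ideal p"
  shows "\<exists>x\<in>\<mm>. \<forall>p\<in>P. x \<in> p \<longrightarrow> p = \<mm>"
proof -
  have "prime_ideal p \<and> \<not> \<mm> \<subseteq> p" if "p \<in> P - {\<mm>}" for p
  proof -
    have "prime_ideal p" "p \<noteq> \<mm>" using assms(2) that by auto
    then show ?thesis using \<mm>_maximal[of p] by (auto simp: prime_ideal_def)
  qed
  then obtain x where "x \<in> \<mm>" "\<forall>p\<in>P - {\<mm>}. x \<notin> p"
    using prime_avoidance[of "P - {\<mm>}" \<mm>] assms(1) ideal_\<mm> by auto
  then show ?thesis by blast
qed

text \<open>
  Every zero divisor on \<open>N / L\<close> lies in one of finitely many primes that are annihilators of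
  elements. An element of \<open>\<mm>\<close> outside all of them except \<open>\<mm>\<close> is a zero divisor only if \<open>\<mm>\<close>
  is such an annihilator, that is, if the socle is nonzero.
\<close>

lemma common_regular_element:
  assumes N: "noetherian_under {} N" "subspace N"
    and L: "\<And>L. L \<in> \<L> \<Longrightarrow> subspace L \<and> L \<subseteq> N \<and> \<not> has_nonzero_socle N L" and "finite \<L>"
  shows "\<exists>x\<in>\<mm>. \<forall>L\<in>\<L>. regular_on N L x"
proof -
  have "\<exists>P. finite P \<and> (\<forall>p\<in>P. prime_ideal p) \<and>
           (\<forall>v\<in>N - L. \<exists>r. r \<odot> v \<notin> L \<and> annihilator L (r \<odot> v) \<in> P)" if "L \<in> \<L>" for L
    by (rule finite_associated_primes[OF ideals_noetherian N(1)]) (use N(2) L[OF that] in auto)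
  then obtain P where P: "\<And>L. L \<in> \<L> \<Longrightarrow> finite (P L) \<and> (\<forall>p\<in>P L. prime_ideal p) \<and>
           (\<forall>v\<in>N - L. \<exists>r. r \<odot> v \<notin> L \<and> annihilator L (r \<odot> v) \<in> P L)" by metis
  obtain x where x: "x \<in> \<mm>" "\<forall>p\<in>(\<Union>L\<in>\<L>. P L). x \<in> p \<longrightarrow> p = \<mm>"
    using avoid_all_but_\<mm>[of "\<Union>L\<in>\<L>. P L"] P \<open>finite \<L>\<close> by blast
  have "v \<in> L" if v: "L \<in> \<L>" "v \<in> N" "x \<odot> v \<in> L" for L v
  proof (rule ccontr)
    assume "v \<notin> L"
    then obtain r where r: "r \<odot> v \<notin> L" "annihilator L (r \<odot> v) \<in> P L" using P[OF v(1)] v(2) by blast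
    have sL: "subspace L" using L[OF that(1)] by blast
    have "x \<in> annihilator L (r \<odot> v)"
      using annihilator_scale[OF sL, of v r] that(3) by (auto simp: annihilator_def)
    then have "annihilator L (r \<odot> v) = \<mm>" using x r that(1) by blast
    then have "\<forall>a\<in>\<mm>. a \<odot> (r \<odot> v) \<in> L" unfolding annihilator_def by blast
    moreover have "r \<odot> v \<in> N - L" using r(1) subspace_scale[OF N(2) that(2)] by blast
    ultimately have "has_nonzero_socle N L" unfolding has_nonzero_socle_def by blast
    then show False using L[OF that(1)] by blast
  qed
  then show ?thesis using x(1) unfolding regular_on_def by blast
qed

text \<open>
  If \<open>v\<close> represents a socle element modulo \<open>x\<close> and \<open>y v = x w\<close> in \<open>N / L\<close>, then \<open>w\<close>
  represents one modulo \<open>y\<close>.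
\<close>

lemma has_nonzero_socle_change_element:
  assumes N: "subspace N" and L: "subspace L"
    and x: "regular_on N L x" and y: "regular_on N L y" "y \<in> \<mm>"
    and soc: "has_nonzero_socle N (ideal_mult scale N L [x])"
  shows "has_nonzero_socle N (ideal_mult scale N L [y])"
proof -
  note mem = mem_ideal_mult_singleton[OF N L]
  note add = subspace_add[OF L] and diff = subspace_diff[OF L] and scl = subspace_scale[OF L]
  obtain v where v: "v \<in> N" "v \<notin> ideal_mult scale N L [x]"
    and "\<forall>a\<in>\<mm>. a \<odot> v \<in> ideal_mult scale N L [x]"
    using soc unfolding has_nonzero_socle_def by blast
  then have mv: "\<exists>u\<in>N. a \<odot> v - x \<odot> u \<in> L" if "a \<in> \<mm>" for a using that mem by blast
  obtain w where w: "w \<in> N" "y \<odot> v - x \<odot> w \<in> L" using mv[OF y(2)] by blast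
  have "w \<notin> ideal_mult scale N L [y]"
  proof
    assume "w \<in> ideal_mult scale N L [y]"
    then obtain u where u: "u \<in> N" "w - y \<odot> u \<in> L" unfolding mem by blast
    have "y \<odot> (v - x \<odot> u) = (y \<odot> v - x \<odot> w) + x \<odot> (w - y \<odot> u)"
      by (simp add: scale_right_diff_distrib mult.commute)
    then have "y \<odot> (v - x \<odot> u) \<in> L" using add[OF w(2) scl[OF u(2)]] by simp
    moreover have "v - x \<odot> u \<in> N" using v(1) u(1) N by (simp add: subspace_diff subspace_scale)
    ultimately have "v - x \<odot> u \<in> L" using y(1) unfolding regular_on_def by blast
    then show False using v(2) u(1) unfolding mem by blast
  qed
  moreover have "a \<odot> w \<in> ideal_mult scale N L [y]" if a: "a \<in> \<mm>" for a
  proof -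
    obtain u where u: "u \<in> N" "a \<odot> v - x \<odot> u \<in> L" using mv[OF a] by blast
    have "x \<odot> (a \<odot> w - y \<odot> u) = y \<odot> (a \<odot> v - x \<odot> u) - a \<odot> (y \<odot> v - x \<odot> w)"
      by (simp add: scale_right_diff_distrib mult.commute)
    then have "x \<odot> (a \<odot> w - y \<odot> u) \<in> L" using diff[OF scl[OF u(2)] scl[OF w(2)]] by simp
    moreover have "a \<odot> w - y \<odot> u \<in> N" using w(1) u(1) N by (simp add: subspace_diff subspace_scale)
    ultimately have "a \<odot> w - y \<odot> u \<in> L" using x unfolding regular_on_def by blast
    then show ?thesis unfolding mem using u(1) by blast
  qed
  ultimately show ?thesis unfolding has_nonzero_socle_def using w(1) by blast
qed

text \<open>
  The kernel \<open>K\<close> of \<open>z\<close> on \<open>N / L\<close> satisfies \<open>K = x K\<close>, so it vanishes by Nakayama's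
  lemma. This makes regular sequences in \<open>\<mm>\<close> permutable.
\<close>

lemma regular_swap:
  assumes N: "noetherian_under {} N" "subspace N" and L: "subspace L" "L \<subseteq> N"
    and x: "regular_on N L x" "x \<in> \<mm>" and z: "regular_on N (ideal_mult scale N L [x]) z"
  shows "regular_on N L z" and "regular_on N (ideal_mult scale N L [z]) x"
proof -
  note mem = mem_ideal_mult_singleton[OF N(2) L(1)]
  let ?K = "{v \<in> N. z \<odot> v \<in> L}"
  have sK: "subspace ?K"
    by (rule subspaceI)
      (auto simp: subspace_0 L N subspace_add scale_right_distrib scale_left_commute[of z]
        subspace_scale simp del: scale_scale)
  have "?K = L"
  proof (rule nakayama[OF noetherian_under_mono[OF N(1)] sK L(1) _ x(2)])
    show "L \<subseteq> ?K" using L by (auto simp: subspace_scale)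
    fix v assume "v \<in> ?K"
    then have v: "v \<in> N" "z \<odot> v \<in> L" by auto
    then have "z \<odot> v \<in> ideal_mult scale N L [x]" using ideal_mult_superset by blast
    then have "v \<in> ideal_mult scale N L [x]" using z v(1) unfolding regular_on_def by blast
    then obtain w where w: "w \<in> N" "v - x \<odot> w \<in> L" unfolding mem by blast
    have "x \<odot> (z \<odot> w) = z \<odot> v - z \<odot> (v - x \<odot> w)"
      by (simp add: scale_right_diff_distrib mult.commute)
    then have "x \<odot> (z \<odot> w) \<in> L"
      using subspace_diff[OF L(1) v(2) subspace_scale[OF L(1) w(2)]] by simp
    then have "z \<odot> w \<in> L" using x(1) w(1) subspace_scale[OF N(2)] unfolding regular_on_def by blast
    then show "\<exists>w\<in>?K. v - x \<odot> w \<in> L" using w by blast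
  qed auto
  then show "regular_on N L z" unfolding regular_on_def by blast
  show "regular_on N (ideal_mult scale N L [z]) x"
    unfolding regular_on_def
  proof (intro ballI impI)
    fix v assume v: "v \<in> N" "x \<odot> v \<in> ideal_mult scale N L [z]"
    then obtain w where w: "w \<in> N" "x \<odot> v - z \<odot> w \<in> L" unfolding mem by blast
    have "z \<odot> w - x \<odot> v \<in> L" using subspace_neg[OF L(1) w(2)] by simp
    then have "z \<odot> w \<in> ideal_mult scale N L [x]" unfolding mem using v(1) by blast
    then have "w \<in> ideal_mult scale N L [x]" using z w(1) unfolding regular_on_def by blast
    then obtain u where u: "u \<in> N" "w - x \<odot> u \<in> L" unfolding mem by blast
    have "x \<odot> (v - z \<odot> u) = (x \<odot> v - z \<odot> w) + z \<odot> (w - x \<odot> u)"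
      by (simp add: scale_right_diff_distrib mult.commute)
    then have "x \<odot> (v - z \<odot> u) \<in> L"
      using subspace_add[OF L(1) w(2) subspace_scale[OF L(1) u(2)]] by simp
    moreover have "v - z \<odot> u \<in> N" using v(1) u(1) N(2) by (simp add: subspace_diff subspace_scale)
    ultimately have "v - z \<odot> u \<in> L" using x(1) unfolding regular_on_def by blast
    then show "v \<in> ideal_mult scale N L [z]" unfolding mem using u(1) by blast
  qed
qed

lemma weakly_regular_move_last_to_front:
  assumes N: "noetherian_under {} N" "subspace N" and L: "subspace L" "L \<subseteq> N"
    and xs: "set xs \<subseteq> \<mm>" and reg: "weakly_regular N L (xs @ [z])"
  shows "weakly_regular N L (z # xs)"
  using L xs reg
proof (induction xs arbitrary: L)
  case Nil
  then show ?case by simp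
next
  case (Cons x xs)
  let ?Lx = "ideal_mult scale N L [x]" and ?Lz = "ideal_mult scale N L [z]"
  have x: "regular_on N L x" "weakly_regular N ?Lx (xs @ [z])"
    using Cons.prems weakly_regular_Cons[OF Cons.prems(1), of N x "xs @ [z]"] by auto
  have "weakly_regular N ?Lx (z # xs)"
    by (rule Cons.IH) (use x Cons.prems ideal_mult_subset[OF N(2)] in auto)
  then have z: "regular_on N ?Lx z" "weakly_regular N (ideal_mult scale N L [x, z]) xs"
    using weakly_regular_Cons[OF subspace_ideal_mult] by (auto simp: ideal_mult_append)
  have "ideal_mult scale N L [x, z] = ideal_mult scale N L [z, x]" by (rule ideal_mult_cong) auto
  then have "weakly_regular N ?Lz (x # xs)"
    using z(2) regular_swap(2)[OF N Cons.prems(1,2) x(1) _ z(1)] Cons.prems(3)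
    by (simp add: weakly_regular_Cons ideal_mult_append)
  then show ?case
    using regular_swap(1)[OF N Cons.prems(1,2) x(1) _ z(1)] Cons.prems(1,3)
    by (simp add: weakly_regular_Cons)
qed

text \<open>
  For the last elements \<open>x\<close> and \<open>y\<close> of the two sequences, choose \<open>z \<in> \<mm>\<close> that can replace
  both. Moving \<open>z\<close> to the front leaves shorter sequences over \<open>N / (L + z N)\<close>.
\<close>

lemma has_nonzero_socle_change_sequence:
  assumes N: "noetherian_under {} N" "subspace N" and L: "subspace L" "L \<subseteq> N"
    and len: "length xs = length ys" and m: "set xs \<subseteq> \<mm>" "set ys \<subseteq> \<mm>"
    and reg: "weakly_regular N L xs" "weakly_regular N L ys"
    and soc: "has_nonzero_socle N (ideal_mult scale N L xs)"
  shows "has_nonzero_socle N (ideal_mult scale N L ys)"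
  using L len m reg soc
proof (induction "length xs" arbitrary: xs ys L)
  case 0
  then show ?case by simp
next
  case (Suc k)
  obtain xs' x where xs: "xs = xs' @ [x]" using Suc.hyps(2) by (cases xs rule: rev_cases) auto
  obtain ys' y where ys: "ys = ys' @ [y]" using Suc.hyps(2) Suc.prems(3) by (cases ys rule: rev_cases) auto
  let ?X = "ideal_mult scale N L xs'" and ?Y = "ideal_mult scale N L ys'"
  have x: "weakly_regular N L xs'" "regular_on N ?X x" "x \<in> \<mm>" "set xs' \<subseteq> \<mm>"
    and y: "weakly_regular N L ys'" "regular_on N ?Y y" "y \<in> \<mm>" "set ys' \<subseteq> \<mm>"
    using Suc.prems by (auto simp: xs ys weakly_regular_snoc)
  have "\<exists>z\<in>\<mm>. \<forall>K\<in>{?X, ?Y}. regular_on N K z"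
    using x y ideal_mult_subset[OF N(2) Suc.prems(2)] not_has_nonzero_socle_regular
    by (intro common_regular_element[OF N]) auto
  then obtain z where z: "z \<in> \<mm>" "regular_on N ?X z" "regular_on N ?Y z" by blast
  let ?Lz = "ideal_mult scale N L [z]"
  have front: "ideal_mult scale N L (us @ [z]) = ideal_mult scale N ?Lz us" for us
    unfolding ideal_mult_append by (rule ideal_mult_cong) auto
  have "has_nonzero_socle N (ideal_mult scale N ?X [z])"
    by (rule has_nonzero_socle_change_element[OF N(2) _ x(2) z(2,1)])
      (use Suc.prems(8) in \<open>simp_all add: xs ideal_mult_append\<close>)
  then have soc_z: "has_nonzero_socle N (ideal_mult scale N ?Lz xs')" by (simp add: ideal_mult_append front)
  have reg_z: "weakly_regular N ?Lz us"
    if "weakly_regular N L us" "regular_on N (ideal_mult scale N L us) z" "set us \<subseteq> \<mm>" for us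
    using weakly_regular_move_last_to_front[OF N Suc.prems(1,2) that(3), of z] that(1,2)
    by (simp add: weakly_regular_snoc weakly_regular_Cons Suc.prems(1))
  have "has_nonzero_socle N (ideal_mult scale N ?Lz ys')"
    by (rule Suc.hyps(1)[of xs'])
      (use Suc.hyps(2) Suc.prems(3) x y reg_z z soc_z ideal_mult_subset[OF N(2) Suc.prems(2)]
        in \<open>auto simp: xs ys\<close>)
  then have "has_nonzero_socle N (ideal_mult scale N ?Y [z])" by (simp add: ideal_mult_append front)
  then have "has_nonzero_socle N (ideal_mult scale N ?Y [y])"
    by (rule has_nonzero_socle_change_element[OF N(2) _ z(3) y(2,3), rotated]) simp
  then show ?case by (simp add: ys ideal_mult_append)
qed

text \<open>
  A longer regular sequence would have an initial part of the length of \<open>xs\<close> modulo which the socle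
  is nonzero as well, and then no element of \<open>\<mm>\<close> could follow.
\<close>

lemma depth_quotient_eq_length:
  assumes N: "noetherian_under {} N" "subspace N" and L: "subspace L" "L \<subseteq> N"
    and xs: "set xs \<subseteq> \<mm>" "weakly_regular N L xs" and soc: "has_nonzero_socle N (ideal_mult scale N L xs)"
  shows "depth_quotient scale \<mm> N L = enat (length xs)"
proof -
  have ne: "ideal_mult scale N L xs \<noteq> N" using soc by (auto simp: has_nonzero_socle_def)
  then have "N \<noteq> L" using ideal_mult_subset[OF N(2) L(2)] ideal_mult_superset[of L N xs] by blast
  moreover have "Sup {enat (length ys) | ys. set ys \<subseteq> \<mm> \<and> regular_sequence scale N L ys}
      = enat (length xs)"
  proof (rule Sup_eqI)
    fix d assume "d \<in> {enat (length ys) | ys. set ys \<subseteq> \<mm> \<and> regular_sequence scale N L ys}"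
    then obtain ys where d: "d = enat (length ys)" and ys: "set ys \<subseteq> \<mm>" "weakly_regular N L ys"
      by (auto simp: regular_sequence_iff)
    have "length ys \<le> length xs"
    proof (rule ccontr)
      let ?k = "length xs"
      assume "\<not> length ys \<le> ?k"
      then have k: "?k < length ys" by simp
      have "has_nonzero_socle N (ideal_mult scale N L (take ?k ys))"
        by (rule has_nonzero_socle_change_sequence[OF N L _ xs(1) _ xs(2) weakly_regular_take[OF ys(2)] soc])
          (use k ys(1) set_take_subset[of ?k ys] in auto)
      moreover have "regular_on N (ideal_mult scale N L (take ?k ys)) (ys ! ?k)"
        using ys(2) k by (simp add: weakly_regular_def)
      moreover have "ys ! ?k \<in> \<mm>" using ys(1) k by auto
      ultimately show False using not_has_nonzero_socle_regular by blast
    qed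
    then show "d \<le> enat (length xs)" by (simp add: d)
  next
    fix e assume "\<And>d. d \<in> {enat (length ys) | ys. set ys \<subseteq> \<mm> \<and> regular_sequence scale N L ys} \<Longrightarrow> d \<le> e"
    then show "enat (length xs) \<le> e" using xs ne by (auto simp: regular_sequence_iff)
  qed
  ultimately show ?thesis by (simp add: depth_quotient_def)
qed

end

section \<open>The graded polynomial ring\<close>

interpretation P: R_module "poly_scale :: 'a::comm_ring_1 \<Rightarrow> ('a, 'e) polyring \<Rightarrow> ('a, 'e) polyring"
  by (simp add: R_module_def module_poly_scale)

abbreviation total_degree :: "('e::finite \<Rightarrow>\<^sub>0 nat) \<Rightarrow> nat" where
  "total_degree k \<equiv> \<Sum>i\<in>UNIV. Poly_Mapping.lookup k i"

lemma poly_scale_mult_left: "poly_scale r p * q = poly_scale r (p * q)"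
  and poly_scale_mult_right: "p * poly_scale r q = poly_scale r (p * q)"
  by (simp_all only: poly_scale_def mult.assoc mult.left_commute[of p])

lemma lookup_poly_scale [simp]: "Poly_Mapping.lookup (poly_scale r p) k = r * Poly_Mapping.lookup p k"
proof -
  have "Poly_Mapping.lookup (Poly_Mapping.map ((*) r) p) k = r * Poly_Mapping.lookup p k"
    by (simp add: map.rep_eq when_def)
  then show ?thesis by (simp add: poly_scale_def mult_map_scale_conv_mult)
qed

lemma poly_scale_single [simp]: "poly_scale r (Poly_Mapping.single k c) = Poly_Mapping.single k (r * c)"
  by (simp add: poly_scale_def mult_single)

lemma sum_monomials:
  fixes p :: "'k \<Rightarrow>\<^sub>0 'a::comm_monoid_add"
  shows "(\<Sum>k\<in>Poly_Mapping.keys p. Poly_Mapping.single k (Poly_Mapping.lookup p k)) = p"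
  by (rule poly_mapping_eqI) (auto simp: lookup_sum lookup_single when_def not_in_keys_iff_lookup_eq_zero)

lemma module_hom_mult: "module_hom poly_scale poly_scale ((*) q)"
  by (intro module_hom.intro module_hom_axioms.intro module_poly_scale)
    (simp_all add: distrib_left poly_scale_mult_right)

lemma module_hom_linear_form: "module_hom (*s) poly_scale linear_form"
  by (intro module_hom.intro module_hom_axioms.intro module_poly_scale module_vector_scalar_mult)
    (simp_all add: linear_form_def single_add sum.distrib P.scale_sum_right)

lemma Sym_pow_lookup:
  "p \<in> Sym_pow n \<longleftrightarrow> (\<forall>k. Poly_Mapping.lookup p k \<noteq> 0 \<longrightarrow> total_degree k = n)"
  by (auto simp: Sym_pow_def in_keys_iff)

lemma single_in_Sym_pow: "total_degree k = n \<Longrightarrow> Poly_Mapping.single k c \<in> Sym_pow n"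
  by (auto simp: Sym_pow_lookup lookup_single when_def)

lemma linear_form_in_Sym_pow: "linear_form v \<in> Sym_pow 1"
  unfolding linear_form_def
  by (intro P.subspace_sum subspace_Sym_pow single_in_Sym_pow) (auto simp: lookup_single when_def)

lemma mult_in_Sym_pow:
  assumes "p \<in> Sym_pow i" "q \<in> Sym_pow j"
  shows "p * q \<in> Sym_pow (i + j)"
  unfolding Sym_pow_def mem_Collect_eq
proof
  fix k assume "k \<in> Poly_Mapping.keys (p * q)"
  then obtain a b where "k = a + b" "a \<in> Poly_Mapping.keys p" "b \<in> Poly_Mapping.keys q"
    using keys_mult by blast
  with assms show "total_degree k = i + j"
    by (simp add: Sym_pow_def lookup_add sum.distrib)
qed

lemma linear_form_mult_in_Sym_pow: "p \<in> Sym_pow n \<Longrightarrow> linear_form v * p \<in> Sym_pow (Suc n)"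
  using mult_in_Sym_pow[OF linear_form_in_Sym_pow] by fastforce

lemma finite_total_degree: "finite {k :: 'e::finite \<Rightarrow>\<^sub>0 nat. total_degree k = n}"
proof (rule finite_imageD[where f = Poly_Mapping.lookup])
  have "Poly_Mapping.lookup k i \<le> total_degree k" for k :: "'e \<Rightarrow>\<^sub>0 nat" and i
    by (rule member_le_sum) auto
  then have "Poly_Mapping.lookup ` {k :: 'e \<Rightarrow>\<^sub>0 nat. total_degree k = n} \<subseteq> PiE UNIV (\<lambda>_. {..n})"
    by auto
  then show "finite (Poly_Mapping.lookup ` {k :: 'e \<Rightarrow>\<^sub>0 nat. total_degree k = n})"
    by (rule finite_subset) (auto intro: finite_PiE)
qed (rule inj_onI, erule poly_mapping.lookup_inject[THEN iffD1])

lemma noetherian_Sym_pow: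
  assumes "ideal.noetherian_under {} (UNIV :: 'a::comm_ring_1 set)"
  shows "P.noetherian_under {} (Sym_pow n :: ('a, 'e::finite) polyring set)"
proof (rule P.noetherian_under_mono)
  let ?B = "(\<lambda>k. Poly_Mapping.single k 1) ` {k :: 'e \<Rightarrow>\<^sub>0 nat. total_degree k = n}"
  show "P.noetherian_under {} (P.span ?B :: ('a, 'e) polyring set)"
    by (intro P.noetherian_span_finite assms finite_imageI finite_total_degree)
  show "Sym_pow n \<subseteq> (P.span ?B :: ('a, 'e) polyring set)"
  proof
    fix p :: "('a, 'e) polyring" assume p: "p \<in> Sym_pow n"
    have "Poly_Mapping.single k (Poly_Mapping.lookup p k) \<in> P.span ?B"
      if "k \<in> Poly_Mapping.keys p" for k
    proof -
      have "Poly_Mapping.single k 1 \<in> P.span ?B"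
        using p that by (intro P.span_base) (auto simp: Sym_pow_def)
      from P.span_scale[OF this, of "Poly_Mapping.lookup p k"] show ?thesis by simp
    qed
    then have "(\<Sum>k\<in>Poly_Mapping.keys p. Poly_Mapping.single k (Poly_Mapping.lookup p k)) \<in> P.span ?B"
      by (rule P.span_sum)
    then show "p \<in> P.span ?B" by (simp add: sum_monomials)
  qed
qed

definition homogeneous_part :: "nat \<Rightarrow> ('a::comm_ring_1, 'e::finite) polyring \<Rightarrow> ('a, 'e) polyring" where
  "homogeneous_part n p = (\<Sum>k\<in>{k \<in> Poly_Mapping.keys p. total_degree k = n}.
     Poly_Mapping.single k (Poly_Mapping.lookup p k))"

lemma lookup_homogeneous_part:
  "Poly_Mapping.lookup (homogeneous_part n p) k = (Poly_Mapping.lookup p k when total_degree k = n)"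
  by (auto simp: homogeneous_part_def lookup_sum lookup_single when_def not_in_keys_iff_lookup_eq_zero)

lemma module_hom_homogeneous_part: "module_hom poly_scale poly_scale (homogeneous_part n)"
  by (intro module_hom.intro module_hom_axioms.intro module_poly_scale)
    (auto intro!: poly_mapping_eqI simp: lookup_homogeneous_part lookup_add when_def)

lemmas homogeneous_part_add = module_hom.add[OF module_hom_homogeneous_part]
  and homogeneous_part_scale = module_hom.scale[OF module_hom_homogeneous_part]
  and homogeneous_part_zero [simp] = module_hom.zero[OF module_hom_homogeneous_part]

lemma homogeneous_part_homogeneous: "p \<in> Sym_pow m \<Longrightarrow> homogeneous_part n p = (if n = m then p else 0)"
  by (rule poly_mapping_eqI) (auto simp: lookup_homogeneous_part Sym_pow_lookup when_def)

lemma homogeneous_part_linear_form_mult: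
  "homogeneous_part n (linear_form v * p) = (case n of 0 \<Rightarrow> 0 | Suc m \<Rightarrow> linear_form v * homogeneous_part m p)"
proof -
  let ?f = "\<lambda>k. Poly_Mapping.single k (Poly_Mapping.lookup p k)"
  have *: "homogeneous_part n (linear_form v * ?f k) =
      (case n of 0 \<Rightarrow> 0 | Suc m \<Rightarrow> linear_form v * homogeneous_part m (?f k))" for k
    using homogeneous_part_homogeneous[OF linear_form_mult_in_Sym_pow[OF single_in_Sym_pow[OF refl]],
        of n v k "Poly_Mapping.lookup p k"]
      homogeneous_part_homogeneous[OF single_in_Sym_pow[OF refl], of _ k "Poly_Mapping.lookup p k"]
    by (auto split: nat.split)
  have "homogeneous_part n (linear_form v * p) = (\<Sum>k\<in>Poly_Mapping.keys p. homogeneous_part n (linear_form v * ?f k))"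
    by (subst sum_monomials[of p, symmetric])
      (simp only: sum_distrib_left module_hom.sum[OF module_hom_homogeneous_part])
  also have "\<dots> = (case n of 0 \<Rightarrow> 0 | Suc m \<Rightarrow>
      linear_form v * homogeneous_part m (\<Sum>k\<in>Poly_Mapping.keys p. ?f k))"
    unfolding * by (simp add: sum_distrib_left module_hom.sum[OF module_hom_homogeneous_part] split: nat.split)
  finally show ?thesis by (simp only: sum_monomials)
qed

lemma linear_form_axis: "linear_form (axis i 1) = Poly_Mapping.single (Poly_Mapping.single i 1) 1"
proof -
  have "linear_form (axis i 1) =
      (\<Sum>j\<in>UNIV. if j = i then Poly_Mapping.single (Poly_Mapping.single i 1) 1 else 0)"
    unfolding linear_form_def by (rule sum.cong) (auto simp: axis_def)
  then show ?thesis by simp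
qed

text \<open>The product of the submodules \<open>E\<close>, sitting in degree one, and \<open>X\<close>.\<close>

definition form_product ::
    "('a::comm_ring_1 ^ 'e::finite) set \<Rightarrow> ('a, 'e) polyring set \<Rightarrow> ('a, 'e) polyring set" where
  "form_product E X = P.span {linear_form v * p | v p. v \<in> E \<and> p \<in> X}"

lemma form_product_base: "v \<in> E \<Longrightarrow> p \<in> X \<Longrightarrow> linear_form v * p \<in> form_product E X"
  unfolding form_product_def by (intro P.span_base) blast

lemma form_product_minimal:
  assumes "P.subspace T" "\<And>v p. v \<in> E \<Longrightarrow> p \<in> X \<Longrightarrow> linear_form v * p \<in> T"
  shows "form_product E X \<subseteq> T"
  unfolding form_product_def using assms by (intro P.span_minimal) auto

lemma subspace_form_product [simp]: "P.subspace (form_product E X)"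
  by (simp add: form_product_def)

lemma form_product_mono: "X \<subseteq> Y \<Longrightarrow> form_product E X \<subseteq> form_product E Y"
  unfolding form_product_def by (intro P.span_mono) auto

lemma Sym_pow_Suc_subset:
  "(Sym_pow (Suc n) :: ('a::comm_ring_1, 'e::finite) polyring set) \<subseteq> form_product UNIV (Sym_pow n)"
proof
  fix p :: "('a, 'e) polyring" assume p: "p \<in> Sym_pow (Suc n)"
  have "Poly_Mapping.single k c \<in> form_product UNIV (Sym_pow n)"
    if k: "total_degree k = Suc n" for k :: "'e \<Rightarrow>\<^sub>0 nat" and c :: 'a
  proof -
    have "\<exists>i. Poly_Mapping.lookup k i \<noteq> 0" using k by (metis nat.distinct(1) sum.neutral)
    then obtain i where i: "Poly_Mapping.lookup k i \<noteq> 0" ..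
    define k' where "k' = k - Poly_Mapping.single i 1"
    have kk': "k = Poly_Mapping.single i 1 + k'"
      by (rule poly_mapping_eqI) (use i in \<open>auto simp: k'_def lookup_add lookup_minus lookup_single when_def\<close>)
    have "total_degree k = 1 + total_degree k'"
      by (subst kk') (simp add: lookup_add lookup_single when_def sum.distrib)
    then have "Poly_Mapping.single k' c \<in> Sym_pow n" using k by (intro single_in_Sym_pow) simp
    moreover have "Poly_Mapping.single k c = linear_form (axis i 1) * Poly_Mapping.single k' c"
      by (simp add: linear_form_axis mult_single kk')
    ultimately show ?thesis by (simp add: form_product_base)
  qed
  then have "(\<Sum>k\<in>Poly_Mapping.keys p. Poly_Mapping.single k (Poly_Mapping.lookup p k))
      \<in> form_product UNIV (Sym_pow n)"
    using p by (intro P.subspace_sum subspace_form_product) (auto simp: Sym_pow_def)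
  then show "p \<in> form_product UNIV (Sym_pow n)" by (simp only: sum_monomials)
qed

lemma subspace_linear_form_preimage:
  assumes "P.subspace T"
  shows "module.subspace (*s) {v. linear_form v * p \<in> T}"
proof -
  interpret h: module_hom "(*s)" poly_scale linear_form by (rule module_hom_linear_form)
  show ?thesis
    by (rule h.m1.subspaceI)
      (use assms in \<open>auto simp: h.add h.scale distrib_right poly_scale_mult_left
        P.subspace_0 P.subspace_add P.subspace_scale\<close>)
qed

lemma subspace_mult_preimage: "P.subspace T \<Longrightarrow> P.subspace {p. q * p \<in> T}"
  by (rule module_hom.subspace_linear_preimage[OF module_hom_mult])

lemma Rees_pow_0:
  fixes E :: "('a::comm_ring_1 ^ 'e::finite) set"
  shows "Rees_pow E 0 = Sym_pow 0"
proof
  show "Sym_pow 0 \<subseteq> Rees_pow E 0"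
  proof
    fix p :: "('a, 'e) polyring" assume p: "p \<in> Sym_pow 0"
    have "p = poly_scale (Poly_Mapping.lookup p 0) 1"
    proof (rule poly_mapping_eqI)
      fix k
      have "Poly_Mapping.lookup p k = 0" if "k \<noteq> 0"
      proof (rule ccontr)
        assume "Poly_Mapping.lookup p k \<noteq> 0"
        then have "total_degree k = 0" using p by (simp add: Sym_pow_lookup)
        then have "k = 0" by (intro poly_mapping_eqI) simp
        then show False using that by simp
      qed
      then show "Poly_Mapping.lookup p k = Poly_Mapping.lookup (poly_scale (Poly_Mapping.lookup p 0) 1) k"
        by (cases "k = 0") (auto simp: lookup_one)
    qed
    moreover have "poly_scale (Poly_Mapping.lookup p 0) 1 \<in> Rees_pow E 0"
      unfolding Rees_pow_def by (intro P.span_scale P.span_base) auto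
    ultimately show "p \<in> Rees_pow E 0" by (rule ssubst)
  qed
qed (rule Rees_pow_subset_Sym_pow)

lemma Rees_pow_Suc: "Rees_pow E (Suc n) = form_product E (Rees_pow E n)"
proof
  show "Rees_pow E (Suc n) \<subseteq> form_product E (Rees_pow E n)"
    unfolding Rees_pow_def[of E "Suc n"]
  proof (rule P.span_minimal)
    show "{\<Prod>v\<leftarrow>vs. linear_form v |vs. length vs = Suc n \<and> set vs \<subseteq> E} \<subseteq> form_product E (Rees_pow E n)"
    proof
      fix p assume "p \<in> {\<Prod>v\<leftarrow>vs. linear_form v |vs. length vs = Suc n \<and> set vs \<subseteq> E}"
      then obtain v vs where vs: "length vs = n" "set vs \<subseteq> E" "v \<in> E"
        and p: "p = linear_form v * (\<Prod>v\<leftarrow>vs. linear_form v)"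
        by (auto simp: length_Suc_conv)
      have "(\<Prod>v\<leftarrow>vs. linear_form v) \<in> Rees_pow E n"
        unfolding Rees_pow_def using vs by (intro P.span_base) auto
      then show "p \<in> form_product E (Rees_pow E n)" using vs(3) by (simp add: p form_product_base)
    qed
  qed simp
  show "form_product E (Rees_pow E n) \<subseteq> Rees_pow E (Suc n)"
  proof (rule form_product_minimal)
    show "P.subspace (Rees_pow E (Suc n))" by (simp add: Rees_pow_def)
    fix v p assume v: "v \<in> E" and p: "p \<in> Rees_pow E n"
    have "Rees_pow E n \<subseteq> {p. linear_form v * p \<in> Rees_pow E (Suc n)}"
      unfolding Rees_pow_def[of E n]
    proof (rule P.span_minimal)
      show "{\<Prod>v\<leftarrow>vs. linear_form v |vs. length vs = n \<and> set vs \<subseteq> E}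
          \<subseteq> {p. linear_form v * p \<in> Rees_pow E (Suc n)}"
      proof
        fix p assume "p \<in> {\<Prod>v\<leftarrow>vs. linear_form v |vs. length vs = n \<and> set vs \<subseteq> E}"
        then obtain vs where vs: "length vs = n" "set vs \<subseteq> E" "p = (\<Prod>v\<leftarrow>vs. linear_form v)" by blast
        have "(\<Prod>u\<leftarrow>v # vs. linear_form u) \<in> Rees_pow E (Suc n)"
          unfolding Rees_pow_def using vs v by (intro P.span_base) (auto intro!: exI[of _ "v # vs"])
        then show "p \<in> {p. linear_form v * p \<in> Rees_pow E (Suc n)}" by (simp add: vs(3))
      qed
      show "P.subspace {p. linear_form v * p \<in> Rees_pow E (Suc n)}"
        by (rule subspace_mult_preimage) (simp add: Rees_pow_def)
    qed
    then show "linear_form v * p \<in> Rees_pow E (Suc n)" using p by blast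
  qed
qed

lemma subspace_Rees_pow [simp]: "P.subspace (Rees_pow E n)"
  by (simp add: Rees_pow_def)

section \<open>Finiteness over the Rees algebra\<close>

lemma axis_expansion: "v = (\<Sum>i\<in>UNIV. v $ i *s axis i 1)"
  for v :: "'a::comm_ring_1 ^ 'e::finite"
  by (simp add: vec_eq_iff axis_def if_distrib[of "\<lambda>x. _ * x"] cong: if_cong)

lemma span_axes: "module.span (*s) (range (\<lambda>i. axis i 1)) = (UNIV :: ('a::comm_ring_1 ^ 'e::finite) set)"
proof -
  interpret V: R_module "(*s) :: 'a \<Rightarrow> 'a ^ 'e \<Rightarrow> 'a ^ 'e"
    by (simp add: R_module_def module_vector_scalar_mult)
  have "v \<in> V.span (range (\<lambda>i. axis i 1))" for v
    by (subst axis_expansion[of v]) (intro V.span_sum V.span_scale V.span_base, auto)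
  then show ?thesis by blast
qed

lemma finitely_generated_vectors:
  fixes E :: "('a::comm_ring_1 ^ 'e::finite) set"
  assumes R: "ideal.noetherian_under {} (UNIV :: 'a set)" and E: "module.subspace (*s) E"
  obtains B where "finite B" "B \<subseteq> E" "E = module.span (*s) B"
proof -
  interpret V: R_module "(*s) :: 'a \<Rightarrow> 'a ^ 'e \<Rightarrow> 'a ^ 'e"
    by (simp add: R_module_def module_vector_scalar_mult)
  let ?A = "range (\<lambda>i. axis i 1) :: ('a ^ 'e) set"
  have "E \<subseteq> V.span ?A" by (simp add: span_axes)
  moreover have "V.noetherian_under {} (V.span ?A)" by (rule V.noetherian_span_finite[OF R]) simp
  ultimately show ?thesis using V.noetherian_imp_finitely_generated[OF _ E] that by blast
qed

text \<open>
  The closure of \<open>R\<close> under multiplication by finitely many generators of \<open>E\<close> contains all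
  \<open>E\<^sub>n\<close>, and the basis theorem applies to it.
\<close>

lemma Rees_algebra_noetherian:
  fixes E :: "('a::comm_ring_1 ^ 'e::finite) set"
  assumes R: "ideal.noetherian_under {} (UNIV :: 'a set)" and E: "module.subspace (*s) E"
  shows "\<exists>B A. B \<subseteq> E \<and> P.noetherian_under ((\<lambda>b. (*) (linear_form b)) ` B) A \<and>
           P.invariant_subspace ((\<lambda>b. (*) (linear_form b)) ` B) A \<and> (\<forall>n. Rees_pow E n \<subseteq> A)"
proof -
  obtain B where B: "finite B" "B \<subseteq> E" "E = module.span (*s) B"
    using finitely_generated_vectors[OF R E] by blast
  let ?F = "(\<lambda>b. (*) (linear_form b)) ` B :: (('a, 'e) polyring \<Rightarrow> ('a, 'e) polyring) set"
  have "\<exists>A. P.span {1} \<subseteq> A \<and> P.invariant_subspace ?F A \<and> P.noetherian_under ?F A"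
    by (rule P.noetherian_under_finite_operators)
      (auto simp: B(1) module_hom_mult mult.left_commute P.noetherian_span_finite[OF R])
  then obtain A where A: "P.span {1} \<subseteq> A" "P.invariant_subspace ?F A" "P.noetherian_under ?F A"
    by blast
  have sA: "P.subspace A" using A(2) by (simp add: P.invariant_subspace_def)
  have EA: "linear_form v * p \<in> A" if "v \<in> E" "p \<in> A" for v p
  proof -
    have "B \<subseteq> {v. linear_form v * p \<in> A}"
      using A(2) that(2) unfolding P.invariant_subspace_def by blast
    then have "E \<subseteq> {v. linear_form v * p \<in> A}"
      unfolding B(3)
      by (rule module.span_minimal[OF module_vector_scalar_mult _ subspace_linear_form_preimage[OF sA]])
    then show ?thesis using that(1) by blast
  qed
  have "(\<Prod>v\<leftarrow>vs. linear_form v) \<in> A" if "set vs \<subseteq> E" for vs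
    using that
  proof (induction vs)
    case Nil
    then show ?case using A(1) P.span_base[of 1 "{1}"] by auto
  qed (auto simp: EA)
  then have "Rees_pow E n \<subseteq> A" for n
    unfolding Rees_pow_def by (intro P.span_minimal sA) auto
  then show ?thesis using A B(2) by blast
qed

text \<open>
  The graded submodules \<open>W\<^sub>0 \<oplus> \<dots> \<oplus> W\<^sub>k \<oplus> E W\<^sub>k \<oplus> E\<^sup>2 W\<^sub>k \<oplus> \<dots>\<close> of the Rees
  algebra increase with \<open>k\<close>, because \<open>E W\<^sub>k \<subseteq> W\<^sub>k\<^sub>+\<^sub>1\<close>. Where they become stationary, this
  inclusion is an equality.
\<close>

lemma eventually_generated_by_forms:
  fixes E :: "('a::comm_ring_1 ^ 'e::finite) set"
  assumes R: "ideal.noetherian_under {} (UNIV :: 'a set)" and E: "module.subspace (*s) E"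
    and W: "\<And>n. P.subspace (W n)" "\<And>n. W n \<subseteq> Rees_pow E n"
    and EW: "\<And>n v p. v \<in> E \<Longrightarrow> p \<in> W n \<Longrightarrow> linear_form v * p \<in> W (Suc n)"
  shows "\<exists>k. \<forall>n\<ge>k. W (Suc n) \<subseteq> form_product E (W n)"
proof -
  obtain B A where B: "B \<subseteq> E" and A: "P.noetherian_under ((\<lambda>b. (*) (linear_form b)) ` B) A"
    "P.invariant_subspace ((\<lambda>b. (*) (linear_form b)) ` B) A" "\<And>n. Rees_pow E n \<subseteq> A"
    using Rees_algebra_noetherian[OF R E] by blast
  define D where "D k n = (if n \<le> k then W n else (form_product E ^^ (n - k)) (W k))" for k n
  define C where "C k = {p \<in> A. \<forall>n. homogeneous_part n p \<in> D k n}" for k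
  have sD: "P.subspace (D k n)" for k n
    by (cases "n - k") (auto simp: D_def W(1))
  have DSuc: "linear_form v * p \<in> D k (Suc n)" if "v \<in> E" "p \<in> D k n" for k n v p
  proof (cases "Suc n \<le> k")
    case True
    then show ?thesis using that EW by (simp add: D_def)
  next
    case False
    then have "D k n = (form_product E ^^ (n - k)) (W k)" by (cases "n = k") (auto simp: D_def)
    moreover have "D k (Suc n) = form_product E ((form_product E ^^ (n - k)) (W k))"
      using False by (simp add: D_def Suc_diff_le)
    ultimately show ?thesis using that by (simp add: form_product_base)
  qed
  have pow_mono: "(form_product E ^^ m) X \<subseteq> (form_product E ^^ m) Y" if "X \<subseteq> Y" for m X Y
    using that by (induction m) (auto simp: form_product_mono)
  have Dmono: "D k n \<subseteq> D (Suc k) n" for k n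
  proof (cases "n \<le> k")
    case False
    then obtain m where m: "n = Suc k + m" by (metis add.commute le_Suc_ex not_less_eq_eq)
    have "form_product E (W k) \<subseteq> W (Suc k)" by (rule form_product_minimal[OF W(1) EW])
    then have "(form_product E ^^ m) (form_product E (W k)) \<subseteq> (form_product E ^^ m) (W (Suc k))"
      by (rule pow_mono)
    moreover have "D k n = (form_product E ^^ Suc m) (W k)" using m by (simp add: D_def)
    moreover have "D (Suc k) n = (form_product E ^^ m) (W (Suc k))" using m by (simp add: D_def)
    ultimately show ?thesis by (simp add: funpow_swap1)
  qed (simp add: D_def)
  have sA: "P.subspace A" using A(2) by (simp add: P.invariant_subspace_def)
  obtain k where k: "\<And>n. n \<ge> k \<Longrightarrow> C n = C k"
  proof (rule P.noetherian_underD[OF A(1), of C])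
    show "C n \<subseteq> C (Suc n)" for n using Dmono unfolding C_def by blast
    show "P.invariant_subspace ((\<lambda>b. (*) (linear_form b)) ` B) (C k)" for k
      unfolding P.invariant_subspace_def
    proof (intro conjI ballI)
      show "P.subspace (C k)"
        by (rule P.subspaceI)
          (auto simp: C_def homogeneous_part_add homogeneous_part_scale P.subspace_0[OF sA] P.subspace_0[OF sD]
            P.subspace_add[OF sA] P.subspace_add[OF sD] P.subspace_scale[OF sA] P.subspace_scale[OF sD])
      fix f assume "f \<in> (\<lambda>b. (*) (linear_form b)) ` B"
      then obtain b where b: "b \<in> B" "f = (*) (linear_form b)" by blast
      have "linear_form b * p \<in> C k" if "p \<in> C k" for p
        unfolding C_def mem_Collect_eq
      proof (intro conjI allI)
        show "linear_form b * p \<in> A" using A(2) b that by (auto simp: C_def P.invariant_subspace_def)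
        show "homogeneous_part n (linear_form b * p) \<in> D k n" for n
          unfolding homogeneous_part_linear_form_mult
          using DSuc[of b] b B that P.subspace_0[OF sD] by (auto simp: C_def split: nat.split)
      qed
      then show "f ` C k \<subseteq> C k" using b(2) by blast
    qed
  qed (auto simp: C_def)
  have "W (Suc n) \<subseteq> form_product E (W n)" if "n \<ge> k" for n
  proof
    fix p assume p: "p \<in> W (Suc n)"
    then have "p \<in> Sym_pow (Suc n)" using W(2) Rees_pow_subset_Sym_pow by blast
    note hom = homogeneous_part_homogeneous[OF this]
    have "p \<in> C (Suc n)"
      using p W(2) A(3) P.subspace_0[OF sD] by (auto simp: C_def hom) (simp add: D_def)
    then have "p \<in> C n" using k[of n] k[of "Suc n"] that by simp
    then have "homogeneous_part (Suc n) p \<in> D n (Suc n)" by (simp add: C_def)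
    then show "p \<in> form_product E (W n)" by (simp add: hom) (simp add: D_def)
  qed
  then show ?thesis by blast
qed

section \<open>Evaluation, and polynomials with coefficients in an ideal\<close>

definition evaluate :: "('e \<Rightarrow> 'a) \<Rightarrow> ('a::comm_ring_1, 'e::finite) polyring \<Rightarrow> 'a" where
  "evaluate c p =
     (\<Sum>k\<in>Poly_Mapping.keys p. Poly_Mapping.lookup p k * (\<Prod>i\<in>UNIV. c i ^ Poly_Mapping.lookup k i))"

lemma evaluate_superset:
  assumes "finite K" "Poly_Mapping.keys p \<subseteq> K"
  shows "evaluate c p =
     (\<Sum>k\<in>K. Poly_Mapping.lookup p k * (\<Prod>i\<in>UNIV. c i ^ Poly_Mapping.lookup k i))"
  unfolding evaluate_def using assms
  by (intro sum.mono_neutral_left) (auto simp: in_keys_iff)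

lemma module_hom_evaluate:
  fixes c :: "'e::finite \<Rightarrow> 'a::comm_ring_1"
  shows "module_hom poly_scale (*) (evaluate c)"
proof (intro module_hom.intro module_hom_axioms.intro module_poly_scale)
  show "module ((*) :: 'a \<Rightarrow> 'a \<Rightarrow> 'a)" by (rule ideal.module_axioms)
  fix p q :: "('a, 'e) polyring" and r
  let ?K = "Poly_Mapping.keys p \<union> Poly_Mapping.keys q"
  have "Poly_Mapping.keys (p + q) \<subseteq> ?K" by (rule Poly_Mapping.keys_add)
  then show "evaluate c (p + q) = evaluate c p + evaluate c q"
    using evaluate_superset[of ?K "p + q" c] evaluate_superset[of ?K p c] evaluate_superset[of ?K q c]
    by (simp add: lookup_add distrib_right sum.distrib)
  have "Poly_Mapping.keys (poly_scale r p) \<subseteq> Poly_Mapping.keys p" by (auto simp: in_keys_iff)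
  then have "evaluate c (poly_scale r p) = (\<Sum>k\<in>Poly_Mapping.keys p.
      Poly_Mapping.lookup (poly_scale r p) k * (\<Prod>i\<in>UNIV. c i ^ Poly_Mapping.lookup k i))"
    by (rule evaluate_superset[OF finite_keys])
  then show "evaluate c (poly_scale r p) = r * evaluate c p"
    unfolding evaluate_def[of c p] by (simp only: sum_distrib_left lookup_poly_scale mult.assoc)
qed

lemma evaluate_single:
  "evaluate c (Poly_Mapping.single k r) = r * (\<Prod>i\<in>UNIV. c i ^ Poly_Mapping.lookup k i)"
  using evaluate_superset[of "{k}" "Poly_Mapping.single k r" c] by simp

lemma evaluate_linear_form_mult:
  "evaluate c (linear_form v * p) = (\<Sum>i\<in>UNIV. v $ i * c i) * evaluate c p"
proof -
  interpret ev: module_hom poly_scale "(*)" "evaluate c" by (rule module_hom_evaluate)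
  let ?m = "\<lambda>k. \<Prod>i\<in>UNIV. c i ^ Poly_Mapping.lookup k i"
  let ?f = "\<lambda>k. Poly_Mapping.single k (Poly_Mapping.lookup p k)"
  have m: "?m (Poly_Mapping.single i 1 + k) = c i * ?m k" for i k
  proof -
    have "?m (Poly_Mapping.single i 1 + k) = (\<Prod>j\<in>UNIV. if j = i then c i else 1) * ?m k"
      unfolding prod.distrib[symmetric]
      by (rule prod.cong) (auto simp: lookup_add lookup_single when_def power_add)
    then show ?thesis by simp
  qed
  have *: "evaluate c (linear_form v * ?f k) = (\<Sum>i\<in>UNIV. v $ i * c i) * evaluate c (?f k)" for k
    unfolding linear_form_def sum_distrib_right ev.sum mult_single evaluate_single m
    by (rule sum.cong[OF refl]) (simp only: mult.assoc mult.left_commute)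
  have "evaluate c (linear_form v * p) = (\<Sum>k\<in>Poly_Mapping.keys p. evaluate c (linear_form v * ?f k))"
    by (subst sum_monomials[of p, symmetric]) (simp only: sum_distrib_left ev.sum)
  also have "\<dots> = (\<Sum>i\<in>UNIV. v $ i * c i) * evaluate c (\<Sum>k\<in>Poly_Mapping.keys p. ?f k)"
    unfolding * by (simp only: sum_distrib_left ev.sum)
  finally show ?thesis by (simp only: sum_monomials)
qed

lemma ideal_mult_right:
  assumes "module.subspace (*) I" "a \<in> I"
  shows "a * c \<in> I"
  using ideal.subspace_scale[OF assms, of c] by (simp only: mult.commute)

definition coeffs_in :: "'a set \<Rightarrow> ('a::comm_ring_1, 'e) polyring set" where
  "coeffs_in I = {p. \<forall>k. Poly_Mapping.lookup p k \<in> I}"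

lemma subspace_coeffs_in:
  assumes "module.subspace (*) I"
  shows "P.subspace (coeffs_in I)"
  by (rule P.subspaceI)
    (use assms in \<open>auto simp: coeffs_in_def lookup_add ideal.subspace_0 ideal.subspace_add ideal.subspace_scale\<close>)

lemma poly_scale_in_coeffs_in:
  assumes "module.subspace (*) I" "a \<in> I"
  shows "poly_scale a p \<in> coeffs_in I"
  using ideal_mult_right[OF assms] by (simp add: coeffs_in_def)

lemma mult_in_coeffs_in:
  assumes I: "module.subspace (*) I" and p: "p \<in> coeffs_in I"
  shows "q * p \<in> coeffs_in I"
proof -
  have "q * Poly_Mapping.single k (Poly_Mapping.lookup p k) \<in> coeffs_in I" for k
  proof -
    have "q * Poly_Mapping.single k (Poly_Mapping.lookup p k)
        = poly_scale (Poly_Mapping.lookup p k) (q * Poly_Mapping.single k 1)"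
      by (simp flip: poly_scale_mult_right)
    moreover have "Poly_Mapping.lookup p k \<in> I" using p by (simp add: coeffs_in_def)
    ultimately show ?thesis using poly_scale_in_coeffs_in[OF I] by (simp only:)
  qed
  then have "(\<Sum>k\<in>Poly_Mapping.keys p. q * Poly_Mapping.single k (Poly_Mapping.lookup p k)) \<in> coeffs_in I"
    by (intro P.subspace_sum subspace_coeffs_in I)
  then show ?thesis by (simp only: sum_monomials flip: sum_distrib_left)
qed

lemma evaluate_coeffs_in:
  assumes "module.subspace (*) I" "p \<in> coeffs_in I"
  shows "evaluate c p \<in> I"
  unfolding evaluate_def using assms
  by (intro ideal.subspace_sum) (auto simp: coeffs_in_def intro: ideal_mult_right)

section \<open>The filtration of \<open>G\<^sub>n\<close> by powers of \<open>E\<close>\<close>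

text \<open>
  The degree \<open>n\<close> part of the \<open>j\<close>-th power of the ideal of \<open>R[t]\<close> generated by \<open>E\<close>. It is
  \<open>G\<^sub>n\<close> for \<open>j = 0\<close> and \<open>E\<^sub>n\<close> for \<open>j = n\<close>.
\<close>

primrec form_power ::
    "('a::comm_ring_1 ^ 'e::finite) set \<Rightarrow> nat \<Rightarrow> nat \<Rightarrow> ('a, 'e) polyring set" where
  "form_power E 0 n = Sym_pow n"
| "form_power E (Suc j) n = (case n of 0 \<Rightarrow> {0} | Suc m \<Rightarrow> form_product E (form_power E j m))"

lemma subspace_form_power [simp]: "P.subspace (form_power E j n)"
  by (cases j) (auto simp: subspace_Sym_pow split: nat.split)

lemma form_power_diagonal: "form_power E n n = Rees_pow E n"
  by (induction n) (simp_all add: Rees_pow_0 Rees_pow_Suc)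

lemma form_power_decreasing: "form_power E (Suc j) n \<subseteq> form_power E j n"
proof (induction j arbitrary: n)
  case 0
  show ?case
  proof (cases n)
    case 0
    then show ?thesis using P.subspace_0[OF subspace_Sym_pow] by auto
  next
    case (Suc m)
    then show ?thesis
      using form_product_minimal[OF subspace_Sym_pow, of E "Sym_pow m" "Suc m"]
        linear_form_mult_in_Sym_pow by auto
  qed
next
  case (Suc j)
  show ?case
  proof (cases n)
    case 0
    then show ?thesis by simp
  next
    case (Suc m)
    have "form_product E (form_power E (Suc j) m) \<subseteq> form_product E (form_power E j m)"
      by (rule form_product_mono[OF Suc.IH])
    moreover have "form_power E (Suc (Suc j)) n = form_product E (form_power E (Suc j) m)"
      using Suc by (simp only: form_power.simps nat.case)
    moreover have "form_power E (Suc j) n = form_product E (form_power E j m)"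
      using Suc by (simp only: form_power.simps nat.case)
    ultimately show ?thesis by (simp only:)
  qed
qed

lemma form_power_mult:
  "p \<in> form_power E j n \<Longrightarrow> linear_form v * p \<in> form_power E j (Suc n)"
proof (induction j arbitrary: n p)
  case 0
  then show ?case by (simp add: linear_form_mult_in_Sym_pow)
next
  case (Suc j)
  show ?case
  proof (cases n)
    case 0
    then show ?thesis using Suc.prems P.subspace_0[OF subspace_form_product] by auto
  next
    case (Suc m)
    have "form_product E (form_power E j m) \<subseteq> {p. linear_form v * p \<in> form_product E (form_power E j (Suc m))}"
    proof (rule form_product_minimal)
      fix e q assume "e \<in> E" "q \<in> form_power E j m"
      then have "linear_form e * (linear_form v * q) \<in> form_product E (form_power E j (Suc m))"
        using Suc.IH by (intro form_product_base) auto
      then show "linear_form e * q \<in> {p. linear_form v * p \<in> form_product E (form_power E j (Suc m))}"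
        by (simp add: mult.left_commute)
    qed (simp add: subspace_mult_preimage)
    then show ?thesis using Suc.prems Suc by auto
  qed
qed

lemma form_power_mult_Suc:
  "v \<in> E \<Longrightarrow> p \<in> form_power E j n \<Longrightarrow> linear_form v * p \<in> form_power E (Suc j) (Suc n)"
  by (simp add: form_product_base)

text \<open>
  The sum of \<open>form_power E j n\<close> and \<open>I G\<^sub>n\<close>. Working modulo \<open>I\<close> in this way replaces the
  passage to the ring \<open>R / I\<close>, which is not a type.
\<close>

definition form_power_mod ::
    "('a::comm_ring_1 ^ 'e::finite) set \<Rightarrow> 'a set \<Rightarrow> nat \<Rightarrow> nat \<Rightarrow> ('a, 'e) polyring set" where
  "form_power_mod E I j n = {p \<in> Sym_pow n. \<exists>a\<in>form_power E j n. p - a \<in> coeffs_in I}"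

lemma form_power_subset_Sym_pow: "form_power E j n \<subseteq> Sym_pow n"
proof (induction j)
  case (Suc j)
  then show ?case using form_power_decreasing[of E j n] by (rule order_trans[rotated])
qed simp

context
  fixes I :: "'a::comm_ring_1 set"
  assumes I: "module.subspace (*) I"
begin

lemma subspace_form_power_mod: "P.subspace (form_power_mod E I j n)"
proof (rule P.subspaceI)
  note S = subspace_Sym_pow[of n] and F = subspace_form_power[of E j n] and C = subspace_coeffs_in[OF I]
  show "0 \<in> form_power_mod E I j n"
    using P.subspace_0[OF S] P.subspace_0[OF F] P.subspace_0[OF C] by (force simp: form_power_mod_def)
  fix p q r assume p: "p \<in> form_power_mod E I j n"
  then obtain a where a: "p \<in> Sym_pow n" "a \<in> form_power E j n" "p - a \<in> coeffs_in I"
    by (auto simp: form_power_mod_def)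
  show "p + q \<in> form_power_mod E I j n" if q: "q \<in> form_power_mod E I j n"
  proof -
    obtain b where b: "q \<in> Sym_pow n" "b \<in> form_power E j n" "q - b \<in> coeffs_in I"
      using q by (auto simp: form_power_mod_def)
    have "p + q - (a + b) \<in> coeffs_in I" using P.subspace_add[OF C a(3) b(3)] by (simp add: algebra_simps)
    then show ?thesis
      using P.subspace_add[OF S a(1) b(1)] P.subspace_add[OF F a(2) b(2)]
      unfolding form_power_mod_def by blast
  qed
  have "poly_scale r p - poly_scale r a \<in> coeffs_in I"
    using P.subspace_scale[OF C a(3), of r] by (simp add: P.scale_right_diff_distrib)
  then show "poly_scale r p \<in> form_power_mod E I j n"
    using P.subspace_scale[OF S a(1)] P.subspace_scale[OF F a(2)]
    unfolding form_power_mod_def by blast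
qed

lemma form_power_subset_mod: "form_power E j n \<subseteq> form_power_mod E I j n"
  using form_power_subset_Sym_pow[of E j n] P.subspace_0[OF subspace_coeffs_in[OF I]]
  by (force simp: form_power_mod_def)

lemma coeffs_in_subset_mod: "p \<in> Sym_pow n \<Longrightarrow> p \<in> coeffs_in I \<Longrightarrow> p \<in> form_power_mod E I j n"
  using P.subspace_0[OF subspace_form_power] by (force simp: form_power_mod_def)

lemma form_power_mod_0: "form_power_mod E I 0 n = Sym_pow n"
  using form_power_subset_mod[of E 0 n] by (auto simp: form_power_mod_def)

lemma form_power_mod_decreasing: "form_power_mod E I (Suc j) n \<subseteq> form_power_mod E I j n"
  using form_power_decreasing[of E j n] unfolding form_power_mod_def by blast

lemma form_power_mod_antimono: "i \<le> j \<Longrightarrow> form_power_mod E I j n \<subseteq> form_power_mod E I i n"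
  using lift_Suc_antimono_le[of "\<lambda>j. form_power_mod E I j n", OF form_power_mod_decreasing] .

lemma form_power_mod_mult:
  assumes "p \<in> form_power_mod E I j n"
  shows "linear_form v * p \<in> form_power_mod E I j (Suc n)"
    and "v \<in> E \<Longrightarrow> linear_form v * p \<in> form_power_mod E I (Suc j) (Suc n)"
proof -
  obtain a where a: "p \<in> Sym_pow n" "a \<in> form_power E j n" "p - a \<in> coeffs_in I"
    using assms by (auto simp: form_power_mod_def)
  have "linear_form v * p - linear_form v * a \<in> coeffs_in I"
    using mult_in_coeffs_in[OF I a(3), of "linear_form v"] by (simp add: right_diff_distrib)
  then show "linear_form v * p \<in> form_power_mod E I j (Suc n)"
    and "v \<in> E \<Longrightarrow> linear_form v * p \<in> form_power_mod E I (Suc j) (Suc n)"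
    using linear_form_mult_in_Sym_pow[OF a(1)] form_power_mult[OF a(2), of v] form_power_mult_Suc[OF _ a(2), of v]
    unfolding form_power_mod_def by blast+
qed

end

lemma ideal_mult_Rees_pow:
  "ideal_mult poly_scale (Sym_pow n) (Rees_pow E n) xs
     = form_power_mod E (module.span (*) (set xs)) n n"
proof
  let ?I = "module.span (*) (set xs)" and ?M = "ideal_mult poly_scale (Sym_pow n) (Rees_pow E n) xs"
  have I: "module.subspace (*) ?I" by simp
  show "?M \<subseteq> form_power_mod E ?I n n"
    unfolding ideal_mult_def
  proof (rule P.span_minimal[OF _ subspace_form_power_mod[OF I]])
    have "Rees_pow E n \<subseteq> form_power_mod E ?I n n"
      using form_power_subset_mod[OF I, of E n n] by (simp only: form_power_diagonal)
    moreover have "poly_scale x v \<in> form_power_mod E ?I n n" if "x \<in> set xs" "v \<in> Sym_pow n" for x v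
      using that ideal.span_base[of x "set xs"]
      by (intro coeffs_in_subset_mod[OF I] P.subspace_scale[OF subspace_Sym_pow] poly_scale_in_coeffs_in[OF I])
    ultimately show "Rees_pow E n \<union> {poly_scale x v |x v. x \<in> set xs \<and> v \<in> Sym_pow n}
        \<subseteq> form_power_mod E ?I n n" by blast
  qed
  show "form_power_mod E ?I n n \<subseteq> ?M"
  proof
    fix p assume "p \<in> form_power_mod E ?I n n"
    then obtain a where p: "p \<in> Sym_pow n" and a: "a \<in> Rees_pow E n" "p - a \<in> coeffs_in ?I"
      by (auto simp: form_power_mod_def form_power_diagonal)
    have "p - a \<in> Sym_pow n"
      using P.subspace_diff[OF subspace_Sym_pow p] a(1) Rees_pow_subset_Sym_pow by blast
    have mono: "Poly_Mapping.single k c \<in> ?M" if k: "total_degree k = n" and c: "c \<in> ?I" for k c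
    proof -
      have "?I \<subseteq> {c. Poly_Mapping.single k c \<in> ?M}"
      proof (rule ideal.span_minimal)
        show "module.subspace (*) {c. Poly_Mapping.single k c \<in> ?M}"
        proof (rule ideal.subspaceI)
          show "b * c \<in> {c. Poly_Mapping.single k c \<in> ?M}"
            if "c \<in> {c. Poly_Mapping.single k c \<in> ?M}" for b c
            using that P.subspace_scale[OF P.subspace_ideal_mult, of "Poly_Mapping.single k c" _ _ _ b] by simp
        qed (auto simp: single_add P.subspace_0 P.subspace_add)
        show "set xs \<subseteq> {c. Poly_Mapping.single k c \<in> ?M}"
        proof
          fix x assume x: "x \<in> set xs"
          have "Poly_Mapping.single k 1 \<in> Sym_pow n" by (rule single_in_Sym_pow[OF k])
          then have "poly_scale x (Poly_Mapping.single k 1) \<in> ?M"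
            unfolding ideal_mult_def using x by (intro P.span_base) blast
          then show "x \<in> {c. Poly_Mapping.single k c \<in> ?M}" by simp
        qed
      qed
      then show ?thesis using c by blast
    qed
    have "(\<Sum>k\<in>Poly_Mapping.keys (p - a). Poly_Mapping.single k (Poly_Mapping.lookup (p - a) k)) \<in> ?M"
      using \<open>p - a \<in> Sym_pow n\<close> a(2)
      by (intro P.subspace_sum P.subspace_ideal_mult mono) (auto simp: Sym_pow_def coeffs_in_def)
    then have "p - a \<in> ?M" by (simp only: sum_monomials)
    moreover have "a \<in> ?M" using a(1) P.ideal_mult_superset by blast
    ultimately show "p \<in> ?M" using P.subspace_add[OF P.subspace_ideal_mult, of "p - a" _ _ _ a] by simp
  qed
qed

section \<open>Socles of the quotients of \<open>G\<^sub>n\<close>\<close>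

locale proper_submodule =
  fixes \<mm> :: "'a::comm_ring_1 set" and E :: "('a ^ 'e::finite) set"
  assumes local_ring: "noetherian_local_ring \<mm>"
    and subspace_E: "module.subspace (*s) E" and proper: "E \<noteq> UNIV"
begin

sublocale noetherian_local_module "poly_scale :: 'a \<Rightarrow> ('a, 'e) polyring \<Rightarrow> ('a, 'e) polyring" \<mm>
  by unfold_locales (rule local_ring)

text \<open>
  If \<open>I\<close> is generated by \<open>xs\<close>, then dividing \<open>G\<^sub>n\<close> by this submodule gives
  \<open>G\<^sub>n / E\<^sub>n\<close> modulo \<open>xs\<close>.
\<close>

abbreviation quotient_kernel :: "'a set \<Rightarrow> nat \<Rightarrow> ('a, 'e) polyring set" where
  "quotient_kernel I n \<equiv> form_power_mod E I n n"

text \<open>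
  Enlarge \<open>E\<close> by as many basis vectors as possible to a proper submodule \<open>F\<close>. Any basis vector
  \<open>e\<close> outside \<open>F\<close> then generates \<open>G\<close> modulo \<open>F\<close>, and the functional is a coordinate along
  \<open>e\<close>; on \<open>F\<close> it has no unit as value, since otherwise \<open>e \<in> F\<close>.
\<close>

lemma functional_vanishing_modulo_\<mm>:
  obtains c i where "c i \<notin> \<mm>" "\<And>v. v \<in> E \<Longrightarrow> (\<Sum>j\<in>UNIV. v $ j * c j) \<in> \<mm>"
proof -
  interpret V: R_module "(*s) :: 'a \<Rightarrow> 'a ^ 'e \<Rightarrow> 'a ^ 'e"
    by (simp add: R_module_def module_vector_scalar_mult)
  define e :: "'e \<Rightarrow> 'a ^ 'e" where "e i = axis i 1" for i
  have basis: "v = (\<Sum>j\<in>UNIV. v $ j *s e j)" for v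
    unfolding e_def by (rule axis_expansion)
  let ?\<T> = "{T. V.span (E \<union> e ` T) \<noteq> UNIV}"
  have "V.span E = E" using subspace_E by simp
  then have "{} \<in> ?\<T>"
    using proper unfolding mem_Collect_eq image_empty Un_empty_right by metis
  moreover have "finite ?\<T>" by simp
  ultimately obtain T where T: "T \<in> ?\<T>" "\<And>T'. T' \<in> ?\<T> \<Longrightarrow> T \<subseteq> T' \<Longrightarrow> T' = T"
    using finite_has_maximal[of ?\<T>] by blast
  let ?F = "V.span (E \<union> e ` T)"
  have "\<exists>i. e i \<notin> ?F"
  proof (rule ccontr)
    assume "\<nexists>i. e i \<notin> ?F"
    then have "v \<in> ?F" for v
      by (subst basis[of v]) (intro V.span_sum V.span_scale, blast)
    then show False using T(1) by blast
  qed
  then obtain i where i: "e i \<notin> ?F" ..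
  then have "i \<notin> T" using V.span_base[of "e i" "E \<union> e ` T"] by blast
  then have "insert i T \<notin> ?\<T>" using T(2)[of "insert i T"] by blast
  then have "V.span (insert (e i) (E \<union> e ` T)) = UNIV" by simp
  then have "\<exists>c. e j - c *s e i \<in> ?F" for j
    using V.span_breakdown_eq[of "e j" "e i" "E \<union> e ` T"] by blast
  then obtain c where c: "\<And>j. e j - c j *s e i \<in> ?F" by metis
  have unit: "a \<in> \<mm>" if a: "a *s e i \<in> ?F" for a
  proof (rule ccontr)
    assume "a \<notin> \<mm>"
    then obtain b where "b * a = 1" using unit_of_notin_\<mm> by blast
    then have "e i \<in> ?F" using V.span_scale[OF a, of b] by simp
    then show False using i by blast
  qed
  show thesis
  proof (rule that[of c i])
    have "(1 - c i) *s e i \<in> ?F" using c[of i] by (simp add: V.scale_left_diff_distrib)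
    then have "1 - c i \<in> \<mm>" by (rule unit)
    then show "c i \<notin> \<mm>"
      using ideal.subspace_add[OF ideal_\<mm>, of "1 - c i" "c i"] one_notin_\<mm> by auto
    fix v assume "v \<in> E"
    then have v: "v \<in> ?F" by (intro V.span_base) blast
    have "(\<Sum>j\<in>UNIV. v $ j *s (e j - c j *s e i)) \<in> ?F"
      by (intro V.span_sum V.span_scale c)
    moreover have "(\<Sum>j\<in>UNIV. v $ j *s (e j - c j *s e i)) = v - (\<Sum>j\<in>UNIV. v $ j * c j) *s e i"
      by (simp only: V.scale_right_diff_distrib V.scale_scale sum_subtractf V.scale_sum_left
          basis[symmetric])
    ultimately have "(\<Sum>j\<in>UNIV. v $ j * c j) *s e i \<in> ?F" using V.span_diff[OF v] by fastforce
    then show "(\<Sum>j\<in>UNIV. v $ j * c j) \<in> \<mm>" by (rule unit)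
  qed
qed

text \<open>
  Evaluating at a suitable point sends \<open>E G\<^sub>n + \<mm> G\<^sub>n\<^sub>+\<^sub>1\<close> into \<open>\<mm>\<close> but the power of
  some variable to a unit.
\<close>

lemma Sym_pow_not_generated:
  "\<exists>p\<in>Sym_pow (Suc n). \<forall>w\<in>form_product E (Sym_pow n). p - w \<notin> coeffs_in \<mm>"
proof -
  obtain c i where c: "c i \<notin> \<mm>" "\<And>v. v \<in> E \<Longrightarrow> (\<Sum>j\<in>UNIV. v $ j * c j) \<in> \<mm>"
    using functional_vanishing_modulo_\<mm> by blast
  interpret ev: module_hom poly_scale "(*)" "evaluate c" by (rule module_hom_evaluate)
  let ?p = "Poly_Mapping.single (Poly_Mapping.single i (Suc n)) 1 :: ('a, 'e) polyring"
  have deg: "total_degree (Poly_Mapping.single i (Suc n)) = Suc n"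
    by (simp add: lookup_single when_def)
  have "evaluate c ?p = (\<Prod>j\<in>UNIV. if j = i then c i ^ Suc n else 1)"
    unfolding evaluate_single mult_1 by (rule prod.cong) (auto simp: lookup_single when_def)
  then have evp: "evaluate c ?p = c i ^ Suc n" by simp
  have pow: "c i ^ m \<notin> \<mm>" for m
    by (induction m) (use c(1) one_notin_\<mm> \<mm>_prime in \<open>auto simp: prime_ideal_def\<close>)
  have "form_product E (Sym_pow n) \<subseteq> {p. evaluate c p \<in> \<mm>}"
    by (rule form_product_minimal[OF ev.subspace_linear_preimage[OF ideal_\<mm>]])
      (simp add: evaluate_linear_form_mult c(2) ideal_mult_right[OF ideal_\<mm>])
  then have "?p - w \<notin> coeffs_in \<mm>" if "w \<in> form_product E (Sym_pow n)" for w
  proof -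
    have "evaluate c w \<in> \<mm>" using that \<open>form_product E (Sym_pow n) \<subseteq> _\<close> by blast
    then have "evaluate c (?p - w) \<notin> \<mm>"
      using ideal.subspace_add[OF ideal_\<mm>, of "evaluate c (?p - w)" "evaluate c w"] pow[of "Suc n"]
      unfolding evp[symmetric] ev.diff by auto
    then show ?thesis using evaluate_coeffs_in[OF ideal_\<mm>] by blast
  qed
  then show ?thesis using single_in_Sym_pow[OF deg] by blast
qed

lemma coeffs_in_mono: "I \<subseteq> J \<Longrightarrow> coeffs_in I \<subseteq> coeffs_in J"
  by (auto simp: coeffs_in_def)

lemma quotient_nonzero:
  assumes I: "I \<subseteq> \<mm>"
  shows "\<exists>p\<in>Sym_pow (Suc n). p \<notin> quotient_kernel I (Suc n)"
proof -
  obtain p where p: "p \<in> Sym_pow (Suc n)" "\<And>w. w \<in> form_product E (Sym_pow n) \<Longrightarrow> p - w \<notin> coeffs_in \<mm>"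
    using Sym_pow_not_generated by blast
  have "form_power E (Suc n) (Suc n) \<subseteq> form_product E (Sym_pow n)"
    using form_product_mono[OF form_power_subset_Sym_pow[of E n n], of E] by simp
  then have "p \<notin> quotient_kernel I (Suc n)"
    using p(2) coeffs_in_mono[OF I] unfolding form_power_mod_def by blast
  then show ?thesis using p(1) by blast
qed

text \<open>
  The preimages in the Rees algebra of \<open>y V\<^sub>n\<close> modulo \<open>I\<close> form an ideal, so they are generated
  over \<open>E\<close> from some degree on. Cancelling \<open>y\<close> yields generators for the elements \<open>p\<close> of \<open>V\<close>
  with \<open>y p\<close> in \<open>E\<^sub>n + I G\<^sub>n\<close>, although \<open>V\<close> itself need not lie in the Rees algebra.
\<close>

lemma eventually_generated_after_multiplication:
  assumes I: "module.subspace (*) I"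
    and V: "\<And>n. P.subspace (V n)" "\<And>n. V n \<subseteq> Sym_pow n"
    and EV: "\<And>n v p. v \<in> E \<Longrightarrow> p \<in> V n \<Longrightarrow> linear_form v * p \<in> V (Suc n)"
  shows "\<exists>k. \<forall>n\<ge>k. \<forall>p\<in>V (Suc n). poly_scale y p \<in> quotient_kernel I (Suc n) \<longrightarrow>
           (\<exists>w\<in>form_product E (V n). poly_scale y (p - w) \<in> coeffs_in I)"
proof -
  note C = subspace_coeffs_in[OF I]
  have lift: "P.subspace {a. \<exists>p\<in>X. a - poly_scale y p \<in> coeffs_in I}" if X: "P.subspace X" for X
  proof (rule P.subspaceI)
    let ?L = "{a. \<exists>p\<in>X. a - poly_scale y p \<in> coeffs_in I}"
    show "0 \<in> ?L" using P.subspace_0[OF X] P.subspace_0[OF C] by force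
  next
    let ?L = "{a. \<exists>p\<in>X. a - poly_scale y p \<in> coeffs_in I}"
    fix a b r assume "a \<in> ?L"
    then obtain p where p: "p \<in> X" "a - poly_scale y p \<in> coeffs_in I" by blast
    show "a + b \<in> ?L" if b: "b \<in> ?L"
    proof -
      obtain q where q: "q \<in> X" "b - poly_scale y q \<in> coeffs_in I" using b by blast
      have "a + b - poly_scale y (p + q) \<in> coeffs_in I"
        using P.subspace_add[OF C p(2) q(2)] by (simp add: P.scale_right_distrib algebra_simps)
      then show ?thesis using P.subspace_add[OF X p(1) q(1)] by blast
    qed
    have "poly_scale r a - poly_scale y (poly_scale r p) \<in> coeffs_in I"
      using P.subspace_scale[OF C p(2), of r] by (simp add: P.scale_right_diff_distrib mult.commute)
    then show "poly_scale r a \<in> ?L" using P.subspace_scale[OF X p(1)] by blast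
  qed
  have mult: "linear_form v * a - poly_scale y (linear_form v * p) \<in> coeffs_in I"
    if "a - poly_scale y p \<in> coeffs_in I" for a p v
    using mult_in_coeffs_in[OF I that, of "linear_form v"]
    by (simp add: right_diff_distrib poly_scale_mult_right)
  define W where "W n = Rees_pow E n \<inter> {a. \<exists>p\<in>V n. a - poly_scale y p \<in> coeffs_in I}" for n
  have "\<exists>k. \<forall>n\<ge>k. W (Suc n) \<subseteq> form_product E (W n)"
  proof (rule eventually_generated_by_forms[OF ideals_noetherian subspace_E])
    show "P.subspace (W n)" for n
      unfolding W_def by (intro P.subspace_inter subspace_Rees_pow lift V(1))
    show "W n \<subseteq> Rees_pow E n" for n by (simp add: W_def)
    show "linear_form v * a \<in> W (Suc n)" if v: "v \<in> E" and a: "a \<in> W n" for n v a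
    proof -
      obtain p where "p \<in> V n" "a - poly_scale y p \<in> coeffs_in I" "a \<in> Rees_pow E n"
        using a by (auto simp: W_def)
      then show ?thesis
        using mult[of a p v] EV[OF v] form_product_base[OF v, of a "Rees_pow E n"]
        unfolding W_def Rees_pow_Suc by blast
    qed
  qed
  then obtain k where k: "\<And>n. n \<ge> k \<Longrightarrow> W (Suc n) \<subseteq> form_product E (W n)" by blast
  have "\<exists>w\<in>form_product E (V n). poly_scale y (p - w) \<in> coeffs_in I"
    if n: "n \<ge> k" and p: "p \<in> V (Suc n)" and yp: "poly_scale y p \<in> quotient_kernel I (Suc n)" for n p
  proof -
    obtain a where a: "a \<in> Rees_pow E (Suc n)" "poly_scale y p - a \<in> coeffs_in I"
      using yp unfolding form_power_mod_def form_power_diagonal by blast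
    then have "a - poly_scale y p \<in> coeffs_in I" using P.subspace_neg[OF C a(2)] by simp
    then have "a \<in> W (Suc n)" using a(1) p unfolding W_def by blast
    then have "a \<in> form_product E (W n)" using k[OF n] by blast
    moreover have "form_product E (W n) \<subseteq> {a. \<exists>p\<in>form_product E (V n). a - poly_scale y p \<in> coeffs_in I}"
    proof (rule form_product_minimal[OF lift[OF subspace_form_product]])
      fix v a assume v: "v \<in> E" and "a \<in> W n"
      then obtain p where "p \<in> V n" "a - poly_scale y p \<in> coeffs_in I" by (auto simp: W_def)
      then show "linear_form v * a \<in> {a. \<exists>p\<in>form_product E (V n). a - poly_scale y p \<in> coeffs_in I}"
        using mult[of a p v] form_product_base[OF v] by blast
    qed
    ultimately obtain w where w: "w \<in> form_product E (V n)" "a - poly_scale y w \<in> coeffs_in I" by blast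
    have "poly_scale y (p - w) = (poly_scale y p - a) + (a - poly_scale y w)"
      by (simp add: P.scale_right_diff_distrib)
    then have "poly_scale y (p - w) \<in> coeffs_in I" using P.subspace_add[OF C a(2) w(2)] by simp
    then show ?thesis using w(1) by blast
  qed
  then show ?thesis by blast
qed

text \<open>
  If \<open>z\<close> represents a socle element of \<open>R / I\<close>, then \<open>z p\<close> represents an element killed by
  \<open>\<mm>\<close> for every \<open>p \<in> G\<^sub>n\<close>. All of these vanish only if \<open>G\<^sub>n = E G\<^sub>n\<^sub>-\<^sub>1 + \<mm> G\<^sub>n\<close>,
  when \<open>n\<close> is large, and this is false since \<open>E\<close> is proper.
\<close>

lemma eventually_socle_if_socle_mod_ideal:
  assumes I: "module.subspace (*) I" and z: "z \<notin> I" "\<And>a. a \<in> \<mm> \<Longrightarrow> a * z \<in> I"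
  shows "\<exists>n\<^sub>0. \<forall>n\<ge>n\<^sub>0. has_nonzero_socle (Sym_pow n) (quotient_kernel I n)"
proof -
  obtain k where k: "\<And>n p. n \<ge> k \<Longrightarrow> p \<in> Sym_pow (Suc n) \<Longrightarrow> poly_scale z p \<in> quotient_kernel I (Suc n) \<Longrightarrow>
      \<exists>w\<in>form_product E (Sym_pow n). poly_scale z (p - w) \<in> coeffs_in I"
    using eventually_generated_after_multiplication[OF I, of Sym_pow z] subspace_Sym_pow
      linear_form_mult_in_Sym_pow by blast
  have "has_nonzero_socle (Sym_pow (Suc n)) (quotient_kernel I (Suc n))" if n: "n \<ge> k" for n
  proof -
    obtain p where p: "p \<in> Sym_pow (Suc n)"
      "\<And>w. w \<in> form_product E (Sym_pow n) \<Longrightarrow> p - w \<notin> coeffs_in \<mm>"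
      using Sym_pow_not_generated by blast
    have "poly_scale z p \<notin> quotient_kernel I (Suc n)"
    proof
      assume "poly_scale z p \<in> quotient_kernel I (Suc n)"
      then obtain w where w: "w \<in> form_product E (Sym_pow n)" "poly_scale z (p - w) \<in> coeffs_in I"
        using k[OF n p(1)] by blast
      have "Poly_Mapping.lookup (p - w) l \<in> \<mm>" for l
      proof (rule ccontr)
        let ?c = "Poly_Mapping.lookup (p - w) l"
        assume "?c \<notin> \<mm>"
        then obtain b where b: "b * ?c = 1" using unit_of_notin_\<mm> by blast
        have "z * ?c \<in> I" using w(2) by (simp add: coeffs_in_def)
        then have "b * (z * ?c) \<in> I" by (rule ideal.subspace_scale[OF I])
        moreover have "b * (z * ?c) = (b * ?c) * z" by (simp only: ac_simps)
        ultimately show False using z(1) b by simp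
      qed
      then show False using p(2)[OF w(1)] by (simp add: coeffs_in_def)
    qed
    moreover have zp: "poly_scale z p \<in> Sym_pow (Suc n)" using P.subspace_scale[OF subspace_Sym_pow p(1)] .
    moreover have "poly_scale a (poly_scale z p) \<in> quotient_kernel I (Suc n)" if "a \<in> \<mm>" for a
    proof (rule coeffs_in_subset_mod[OF I P.subspace_scale[OF subspace_Sym_pow zp]])
      show "poly_scale a (poly_scale z p) \<in> coeffs_in I"
        using poly_scale_in_coeffs_in[OF I z(2)[OF that], of p] by simp
    qed
    ultimately show ?thesis unfolding has_nonzero_socle_def by blast
  qed
  then show ?thesis by (metis Suc_le_D Suc_le_mono)
qed

text \<open>
  If \<open>R / I\<close> has zero socle, some \<open>x \<in> \<mm>\<close> is regular on it and multiplies the elements \<open>V\<^sub>n\<close>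
  that represent the socle in degree \<open>n\<close> injectively into \<open>E\<^sub>n\<close>, modulo \<open>I\<close>. Hence
  \<open>V\<^sub>n\<^sub>+\<^sub>1\<close> is contained in \<open>E V\<^sub>n\<close>, modulo \<open>I\<close>, for large \<open>n\<close>, and a socle that vanishes
  in one of these degrees vanishes from then on.
\<close>

lemma socle_eventually_constant:
  assumes I: "module.subspace (*) I"
  shows "(\<exists>n\<^sub>0. \<forall>n\<ge>n\<^sub>0. has_nonzero_socle (Sym_pow n) (quotient_kernel I n)) \<or>
         (\<exists>n\<^sub>0. \<forall>n\<ge>n\<^sub>0. \<not> has_nonzero_socle (Sym_pow n) (quotient_kernel I n))"
proof -
  interpret R: noetherian_local_module "(*) :: 'a \<Rightarrow> 'a \<Rightarrow> 'a" \<mm>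
    by unfold_locales (rule local_ring)
  show ?thesis
  proof (cases "R.has_nonzero_socle UNIV I")
    case True
    then show ?thesis
      using eventually_socle_if_socle_mod_ideal[OF I] unfolding R.has_nonzero_socle_def by blast
  next
    case False
    then obtain x where x: "x \<in> \<mm>" "\<And>a. x * a \<in> I \<Longrightarrow> a \<in> I"
      using R.common_regular_element[of UNIV "{I}"] I ideals_noetherian
      unfolding ideal.regular_on_def by auto
    define V where "V n = {p \<in> Sym_pow n. \<forall>a\<in>\<mm>. poly_scale a p \<in> quotient_kernel I n}" for n
    note M = subspace_form_power_mod[OF I, of E]
    have sV: "P.subspace (V n)" for n
      by (rule P.subspaceI)
        (auto simp: V_def P.subspace_0[OF M] P.subspace_0[OF subspace_Sym_pow] P.scale_right_distrib
          P.subspace_add[OF M] P.subspace_add[OF subspace_Sym_pow] P.subspace_scale[OF subspace_Sym_pow]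
          P.scale_left_commute P.subspace_scale[OF M] simp del: P.scale_scale)
    have EV: "linear_form v * p \<in> V (Suc n)" if "v \<in> E" "p \<in> V n" for n v p
      using that form_power_mod_mult(2)[OF I, of "poly_scale _ p" E n n v]
      by (auto simp: V_def linear_form_mult_in_Sym_pow poly_scale_mult_right)
    have "V n \<subseteq> Sym_pow n" for n by (auto simp: V_def)
    then obtain k where k: "\<And>n p. n \<ge> k \<Longrightarrow> p \<in> V (Suc n) \<Longrightarrow> poly_scale x p \<in> quotient_kernel I (Suc n) \<Longrightarrow>
        \<exists>w\<in>form_product E (V n). poly_scale x (p - w) \<in> coeffs_in I"
      using eventually_generated_after_multiplication[OF I, of V x] sV EV
      by blast
    have socle_iff: "has_nonzero_socle (Sym_pow n) (quotient_kernel I n) \<longleftrightarrow> \<not> V n \<subseteq> quotient_kernel I n" for n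
      unfolding has_nonzero_socle_def V_def by blast
    have step: "V (Suc n) \<subseteq> quotient_kernel I (Suc n)" if n: "n \<ge> k" and Vn: "V n \<subseteq> quotient_kernel I n" for n
    proof
      fix p assume p: "p \<in> V (Suc n)"
      then have "poly_scale x p \<in> quotient_kernel I (Suc n)" using x(1) by (simp add: V_def)
      then obtain w where w: "w \<in> form_product E (V n)" "poly_scale x (p - w) \<in> coeffs_in I"
        using k[OF n p] by blast
      have "form_product E (V n) \<subseteq> quotient_kernel I (Suc n)"
        using Vn form_power_mod_mult(2)[OF I] by (intro form_product_minimal M) blast
      then have wM: "w \<in> quotient_kernel I (Suc n)" using w(1) by blast
      have "p \<in> Sym_pow (Suc n)" "w \<in> Sym_pow (Suc n)"
        using p wM by (auto simp: V_def form_power_mod_def)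
      then have "p - w \<in> Sym_pow (Suc n)" by (rule P.subspace_diff[OF subspace_Sym_pow])
      moreover have "p - w \<in> coeffs_in I" using w(2) x(2) by (simp add: coeffs_in_def)
      ultimately have "p - w \<in> quotient_kernel I (Suc n)" by (rule coeffs_in_subset_mod[OF I])
      then show "p \<in> quotient_kernel I (Suc n)" using P.subspace_add[OF M _ wM] by force
    qed
    show ?thesis
    proof (cases "\<exists>m\<ge>k. V m \<subseteq> quotient_kernel I m")
      case True
      then obtain m where m: "m \<ge> k" "V m \<subseteq> quotient_kernel I m" by blast
      have "V n \<subseteq> quotient_kernel I n" if "n \<ge> m" for n
        using that by (induction n rule: dec_induct) (use m step in auto)
      then show ?thesis using socle_iff by blast
    next
      case False
      then show ?thesis using socle_iff by blast
    qed
  qed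
qed

end

section \<open>Primes associated to the filtration\<close>

text \<open>
  The polynomials in a new variable \<open>u\<close> over \<open>R[t]\<close>, as an \<open>R\<close>-module. With \<open>E\<close> acting by
  \<open>e u\<close>, the associated graded ring of the ideal generated by \<open>E\<close> becomes a Noetherian
  subquotient.
\<close>

definition poly_poly_scale :: "'a::comm_ring_1 \<Rightarrow> ('a, 'e) polyring poly \<Rightarrow> ('a, 'e) polyring poly" where
  "poly_poly_scale r = smult (Poly_Mapping.single 0 r)"

interpretation PP: R_module "poly_poly_scale :: 'a::comm_ring_1 \<Rightarrow> ('a, 'e) polyring poly \<Rightarrow> ('a, 'e) polyring poly"
  by unfold_locales
    (simp_all add: poly_poly_scale_def smult_add_right smult_add_left single_add mult_single)

lemma coeff_poly_poly_scale [simp]: "coeff (poly_poly_scale r f) j = poly_scale r (coeff f j)"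
  by (simp add: poly_poly_scale_def poly_scale_def)

lemma poly_poly_scale_monom: "poly_poly_scale r (monom p j) = monom (poly_scale r p) j"
  by (rule poly_eqI) simp

lemma module_hom_monom: "module_hom poly_scale poly_poly_scale (\<lambda>p. monom p j)"
  by (intro module_hom.intro module_hom_axioms.intro module_poly_scale PP.module_axioms)
    (simp_all add: add_monom poly_poly_scale_monom)

lemma module_hom_smult: "module_hom poly_poly_scale poly_poly_scale (smult q)"
  by (intro module_hom.intro module_hom_axioms.intro PP.module_axioms)
    (simp_all add: smult_add_right poly_poly_scale_def mult.commute)

lemma module_hom_pCons_smult: "module_hom poly_poly_scale poly_poly_scale (\<lambda>f. pCons 0 (smult q f))"
  by (intro module_hom.intro module_hom_axioms.intro PP.module_axioms)
    (simp_all add: smult_add_right poly_poly_scale_def mult.commute)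

context proper_submodule
begin

text \<open>
  The quotients \<open>G\<^sub>n / E\<^sub>n\<close> need not form a finitely generated module over the Rees algebra, but
  the successive quotients of the filtration of \<open>G\<^sub>n\<close> by \<open>form_power E j n\<close> are the bihomogeneous
  components of the associated graded ring, which is generated by \<open>1\<close> under the \<open>t\<^sub>i\<close> and the
  \<open>e u\<close>. So finitely many primes serve all \<open>j\<close> and \<open>n\<close>.
\<close>

lemma finite_filtration_primes:
  assumes I: "module.subspace (*) I"
  obtains P where "finite P" "\<And>p. p \<in> P \<Longrightarrow> prime_ideal p"
    "\<And>j n w. w \<in> form_power_mod E I j n \<Longrightarrow> w \<notin> form_power_mod E I (Suc j) n \<Longrightarrow>
       \<exists>r. poly_scale r w \<notin> form_power_mod E I (Suc j) n \<and>
         {a. poly_scale a (poly_scale r w) \<in> form_power_mod E I (Suc j) n} \<in> P"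
proof -
  obtain B where B: "finite B" "B \<subseteq> E" "E = module.span (*s) B"
    using finitely_generated_vectors[OF ideals_noetherian subspace_E] by blast
  let ?t = "\<lambda>v. smult (linear_form v) :: ('a, 'e) polyring poly \<Rightarrow> _"
  let ?eu = "\<lambda>v f :: ('a, 'e) polyring poly. pCons 0 (smult (linear_form v) f)"
  let ?F = "?t ` range (\<lambda>i. axis i 1) \<union> ?eu ` B"
  have hom: "module_hom poly_poly_scale poly_poly_scale f" if "f \<in> ?F" for f
    using that module_hom_smult module_hom_pCons_smult by blast
  have "\<exists>N. PP.span {1 :: ('a, 'e) polyring poly} \<subseteq> N \<and> PP.invariant_subspace ?F N \<and> PP.noetherian_under ?F N"
  proof (rule PP.noetherian_under_finite_operators)
    show "finite ?F" using B(1) by simp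
    show "PP.noetherian_under {} (PP.span {1 :: ('a, 'e) polyring poly})" by (rule PP.noetherian_span_finite[OF ideals_noetherian]) simp
  qed (use hom in \<open>auto simp: mult.commute\<close>)
  (* N contains c u^j for every c in the j-th power of the ideal generated by E. Below, L consists of
     the elements of N whose coefficient of u^j lies, modulo I, in the power j + 1, for every j. *)
  then obtain N where N: "PP.span {1} \<subseteq> N" "PP.invariant_subspace ?F N" "PP.noetherian_under ?F N"
    by blast
  have sN: "PP.subspace N" using N(2) by (simp add: PP.invariant_subspace_def)
  note FN = PP.invariant_subspaceD[OF N(2)]
  have monom_mem: "P.subspace {p. monom p j \<in> N}" for j
    using module_hom.subspace_linear_preimage[OF module_hom_monom sN] .
  have act: "monom (linear_form v * p) j' \<in> N"
    if "v \<in> module.span (*s) X" "\<And>x. x \<in> X \<Longrightarrow> monom (linear_form x * p) j' \<in> N" for X v p j'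
  proof -
    have "module.span (*s) X \<subseteq> {v. linear_form v * p \<in> {p. monom p j' \<in> N}}"
      using that(2)
      by (intro module.span_minimal[OF module_vector_scalar_mult] subspace_linear_form_preimage monom_mem) auto
    then show ?thesis using that(1) by blast
  qed
  have act_t: "monom (linear_form v * p) j \<in> N" if p: "monom p j \<in> N" for v p j
  proof (rule act)
    show "v \<in> module.span (*s) (range (\<lambda>i. axis i 1))" by (simp add: span_axes)
    fix x :: "'a ^ 'e" assume "x \<in> range (\<lambda>i. axis i 1)"
    then have "?t x \<in> ?F" by (intro UnI1 imageI)
    from FN[OF this p] have "?t x (monom p j) \<in> N" .
    then show "monom (linear_form x * p) j \<in> N" by (simp add: smult_monom)
  qed
  have act_eu: "monom (linear_form v * p) (Suc j) \<in> N" if v: "v \<in> E" and p: "monom p j \<in> N" for v p j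
  proof (rule act)
    show "v \<in> module.span (*s) B" using v B(3) by blast
    fix x assume "x \<in> B"
    then have "?eu x \<in> ?F" by (intro UnI2 imageI)
    from FN[OF this p] have "?eu x (monom p j) \<in> N" .
    then show "monom (linear_form x * p) (Suc j) \<in> N" by (simp add: smult_monom monom_Suc)
  qed
  have base: "monom p 0 \<in> N" if "p \<in> Sym_pow n" for p n
    using that
  proof (induction n arbitrary: p)
    case 0
    have "Sym_pow 0 \<subseteq> {p. monom p 0 \<in> N}"
      unfolding Rees_pow_0[of UNIV, symmetric] Rees_pow_def
      using N(1) PP.span_base[of 1 "{1}"] by (intro P.span_minimal monom_mem) auto
    then show ?case using 0 by blast
  next
    case (Suc n)
    have "form_product UNIV (Sym_pow n) \<subseteq> {p. monom p 0 \<in> N}"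
      using Suc.IH act_t by (intro form_product_minimal monom_mem) blast
    then show ?case using Suc.prems Sym_pow_Suc_subset by blast
  qed
  have mem: "monom p j \<in> N" if "p \<in> form_power E j n" for p j n
    using that
  proof (induction j arbitrary: n p)
    case 0
    then show ?case using base by simp
  next
    case (Suc j)
    show ?case
    proof (cases n)
      case 0
      then show ?thesis using Suc.prems PP.subspace_0[OF sN] by simp
    next
      case (Suc m)
      have "form_product E (form_power E j m) \<subseteq> {p. monom p (Suc j) \<in> N}"
        using Suc.IH act_eu by (intro form_product_minimal monom_mem) blast
      then show ?thesis using Suc.prems Suc by auto
    qed
  qed
  let ?M = "form_power_mod E I"
  note sM = subspace_form_power_mod[OF I, of E]
  define L where "L = {f \<in> N. \<forall>j n. homogeneous_part n (coeff f j) \<in> ?M (Suc j) n}"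
  have sL: "PP.subspace L"
    by (rule PP.subspaceI)
      (auto simp: L_def homogeneous_part_add homogeneous_part_scale PP.subspace_0[OF sN] PP.subspace_add[OF sN]
        PP.subspace_scale[OF sN] P.subspace_0[OF sM] P.subspace_add[OF sM] P.subspace_scale[OF sM])
  have "f g \<in> L" if f: "f \<in> ?F" and g: "g \<in> L" for f g
  proof -
    have hg: "homogeneous_part n (coeff g j) \<in> ?M (Suc j) n" for j n using g by (simp add: L_def)
    have "g \<in> N" using g by (simp add: L_def)
    with f have "f g \<in> N" by (rule FN)
    moreover have "homogeneous_part n (coeff (f g) j) \<in> ?M (Suc j) n" for j n
      using f
    proof
      assume "f \<in> ?t ` range (\<lambda>i. axis i 1)"
      then obtain v where "f = ?t v" by blast
      then show ?thesis
        using form_power_mod_mult(1)[OF I hg, of v] P.subspace_0[OF sM]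
        by (cases n) (simp_all add: homogeneous_part_linear_form_mult)
    next
      assume "f \<in> ?eu ` B"
      then obtain v where v: "v \<in> E" "f = ?eu v" using B(2) by blast
      show ?thesis
      proof (cases j)
        case 0
        then show ?thesis using P.subspace_0[OF sM] by (simp add: v(2))
      next
        case (Suc i)
        then show ?thesis
          using form_power_mod_mult(2)[OF I hg v(1)] P.subspace_0[OF sM]
          by (cases n) (simp_all add: v(2) homogeneous_part_linear_form_mult)
      qed
    qed
    ultimately show ?thesis by (simp add: L_def)
  qed
  then have L: "PP.invariant_subspace ?F L" using sL unfolding PP.invariant_subspace_def by blast
  have "L \<subseteq> N" by (auto simp: L_def)
  from PP.finite_associated_primes[OF ideals_noetherian N(3,2) L this hom]
  obtain P where P: "finite P" "\<And>p. p \<in> P \<Longrightarrow> prime_ideal p"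
    "\<And>g. g \<in> N - L \<Longrightarrow> \<exists>r. poly_poly_scale r g \<notin> L \<and> PP.annihilator L (poly_poly_scale r g) \<in> P"
    by blast
  have monom_L: "monom p j \<in> L \<longleftrightarrow> p \<in> ?M (Suc j) n" if p: "monom p j \<in> N" "p \<in> Sym_pow n" for p j n
  proof
    assume "monom p j \<in> L"
    then have "homogeneous_part n (coeff (monom p j) j) \<in> ?M (Suc j) n" by (simp only: L_def mem_Collect_eq)
    then show "p \<in> ?M (Suc j) n" by (simp add: homogeneous_part_homogeneous[OF p(2)])
  next
    assume "p \<in> ?M (Suc j) n"
    then show "monom p j \<in> L"
      using p(1) P.subspace_0[OF sM] by (auto simp: L_def homogeneous_part_homogeneous[OF p(2)])
  qed
  show thesis
  proof (rule that[OF P(1,2)])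
    fix j n w assume w: "w \<in> ?M j n" "w \<notin> ?M (Suc j) n"
    then obtain a where a: "w \<in> Sym_pow n" "a \<in> form_power E j n" "w - a \<in> coeffs_in I"
      by (auto simp: form_power_mod_def)
    have aS: "a \<in> Sym_pow n" using a(2) form_power_subset_Sym_pow by blast
    have "w - a \<in> ?M (Suc j) n"
      using P.subspace_diff[OF subspace_Sym_pow a(1) aS] a(3) by (rule coeffs_in_subset_mod[OF I])
    then have eq: "poly_scale r w \<in> ?M (Suc j) n \<longleftrightarrow> poly_scale r a \<in> ?M (Suc j) n" for r
      using P.subspace_add[OF sM P.subspace_scale[OF sM, of "w - a" _ _ r], of _ _ "poly_scale r a"]
        P.subspace_diff[OF sM _ P.subspace_scale[OF sM, of "w - a" _ _ r], of "poly_scale r w"]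
      by (auto simp: P.scale_right_diff_distrib)
    have aN: "monom (poly_scale r a) j \<in> N" for r
      using mem[OF P.subspace_scale[OF subspace_form_power a(2)]] .
    have scaled: "monom (poly_scale r a) j \<in> L \<longleftrightarrow> poly_scale r w \<in> ?M (Suc j) n" for r
      unfolding eq by (rule monom_L[OF aN P.subspace_scale[OF subspace_Sym_pow aS]])
    have "monom a j \<in> N - L" using scaled[of 1] aN[of 1] w(2) by simp
    then obtain r where r: "poly_poly_scale r (monom a j) \<notin> L"
      "PP.annihilator L (poly_poly_scale r (monom a j)) \<in> P" using P(3) by blast
    have "PP.annihilator L (poly_poly_scale r (monom a j))
        = {b. poly_scale b (poly_scale r w) \<in> ?M (Suc j) n}"
      unfolding PP.annihilator_def
      by (simp add: poly_poly_scale_monom scaled)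
    then show "\<exists>r. poly_scale r w \<notin> ?M (Suc j) n \<and>
         {a. poly_scale a (poly_scale r w) \<in> ?M (Suc j) n} \<in> P"
      using r by (auto simp: poly_poly_scale_monom scaled)
  qed
qed

text \<open>
  An associated prime of \<open>G\<^sub>n / E\<^sub>n\<close>, modulo \<open>I\<close>, is among those of the filtration. So an
  element of \<open>\<mm>\<close> outside all of the latter except \<open>\<mm>\<close> can fail to be regular only where the
  socle is nonzero.
\<close>

lemma eventually_common_regular_element:
  assumes I: "module.subspace (*) I"
    and soc: "\<And>n. n \<ge> n\<^sub>0 \<Longrightarrow> \<not> has_nonzero_socle (Sym_pow n) (quotient_kernel I n)"
  shows "\<exists>x\<in>\<mm>. \<forall>n\<ge>n\<^sub>0. P.regular_on (Sym_pow n) (quotient_kernel I n) x"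
proof -
  let ?M = "form_power_mod E I"
  note sM = subspace_form_power_mod[OF I, of E]
  obtain P where P: "finite P" "\<And>p. p \<in> P \<Longrightarrow> prime_ideal p"
    "\<And>j n w. w \<in> ?M j n \<Longrightarrow> w \<notin> ?M (Suc j) n \<Longrightarrow>
       \<exists>r. poly_scale r w \<notin> ?M (Suc j) n \<and> {a. poly_scale a (poly_scale r w) \<in> ?M (Suc j) n} \<in> P"
    using finite_filtration_primes[OF I] by blast
  obtain x where x: "x \<in> \<mm>" "\<And>p. p \<in> P \<Longrightarrow> x \<in> p \<Longrightarrow> p = \<mm>"
    using avoid_all_but_\<mm>[OF P(1,2)] by blast
  have "v \<in> ?M n n" if n: "n \<ge> n\<^sub>0" and v: "v \<in> Sym_pow n" and xv: "poly_scale x v \<in> ?M n n" for n v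
  proof (rule ccontr)
    assume "v \<notin> ?M n n"
    (* The last stage of the filtration that the multiples of v meet nontrivially modulo M n n. *)
    define meets where "meets j \<longleftrightarrow> j \<le> n \<and> (\<exists>r. poly_scale r v \<in> ?M j n - ?M n n)" for j
    have "meets 0"
      unfolding meets_def form_power_mod_0[OF I] using v \<open>v \<notin> ?M n n\<close> by (auto intro!: exI[of _ 1])
    then obtain j where j: "meets j" "\<And>i. meets i \<Longrightarrow> i \<le> j"
      using GreatestI_nat[of meets 0 n] Greatest_le_nat[of meets _ n] unfolding meets_def by blast
    then obtain r where r: "poly_scale r v \<in> ?M j n" "poly_scale r v \<notin> ?M n n" and "j \<le> n"
      unfolding meets_def by blast
    then have jn: "Suc j \<le> n" by (cases "j = n") auto
    have not_meets: "poly_scale b v \<in> ?M n n" if "poly_scale b v \<in> ?M (Suc j) n" for b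
      using j(2)[of "Suc j"] that jn unfolding meets_def by auto
    have sub: "?M n n \<subseteq> ?M (Suc j) n" by (rule form_power_mod_antimono[OF I jn])
    obtain r' where r': "poly_scale r' (poly_scale r v) \<notin> ?M (Suc j) n"
      "{a. poly_scale a (poly_scale r' (poly_scale r v)) \<in> ?M (Suc j) n} \<in> P"
      using P(3)[OF r(1)] not_meets r(2) by blast
    let ?w = "poly_scale (r' * r) v"
    have w: "?w \<notin> ?M (Suc j) n" using r'(1) by simp
    have ann: "{a. poly_scale a ?w \<in> ?M (Suc j) n} \<in> P" using r'(2) by simp
    have "poly_scale x ?w = poly_scale (r' * r) (poly_scale x v)" by (simp add: mult.commute)
    then have "poly_scale x ?w \<in> ?M n n" using P.subspace_scale[OF sM xv] by simp
    then have "{a. poly_scale a ?w \<in> ?M (Suc j) n} = \<mm>" using x(2)[OF ann] sub by blast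
    then have "poly_scale a ?w \<in> ?M n n" if "a \<in> \<mm>" for a
      using not_meets[of "a * (r' * r)"] that by auto
    moreover have "?w \<in> Sym_pow n" by (rule P.subspace_scale[OF subspace_Sym_pow v])
    ultimately have "has_nonzero_socle (Sym_pow n) (?M n n)" using w sub unfolding has_nonzero_socle_def by blast
    then show False using soc[OF n] by blast
  qed
  then show ?thesis using x(1) unfolding P.regular_on_def by blast
qed

section \<open>The limit of the depths\<close>

text \<open>
  Among the sequences in \<open>\<mm>\<close> that are regular on \<open>G\<^sub>n / E\<^sub>n\<close> for all large \<open>n\<close>, choose one
  that generates a maximal ideal of this kind. It cannot be prolonged, as a further regular element
  lies outside that ideal; hence the socle modulo it is eventually nonzero.
\<close>

lemma depth_eventually_constant:
  "\<exists>d n\<^sub>0. \<forall>n\<ge>n\<^sub>0. depth_quotient poly_scale \<mm> (Sym_pow n) (Rees_pow E n) = d"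
proof -
  define good where "good xs \<longleftrightarrow> set xs \<subseteq> \<mm> \<and>
    (\<exists>n\<^sub>0. \<forall>n\<ge>n\<^sub>0. P.weakly_regular (Sym_pow n) (Rees_pow E n) xs)" for xs
  let ?I = "\<lambda>xs :: 'a list. module.span (*) (set xs)"
  let ?\<I> = "{?I xs | xs. good xs}"
  have "good []" by (simp add: good_def)
  then have "?I [] \<in> ?\<I>" by blast
  then have "\<exists>J\<in>?\<I>. \<forall>K\<in>?\<I>. J \<subseteq> K \<longrightarrow> K = J"
    by (rule ideal.noetherian_under_maximal[OF ideals_noetherian]) auto
  then obtain J where "J \<in> ?\<I>" and max: "\<forall>K\<in>?\<I>. J \<subseteq> K \<longrightarrow> K = J" by (rule bexE)
  then obtain xs where J: "J = ?I xs" and "good xs" by blast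
  then obtain n1 where xs: "set xs \<subseteq> \<mm>"
    and n1: "\<And>n. n \<ge> n1 \<Longrightarrow> P.weakly_regular (Sym_pow n) (Rees_pow E n) xs"
    unfolding good_def by blast
  have sJ: "module.subspace (*) J" by (simp add: J)
  have "J \<subseteq> \<mm>" unfolding J by (rule ideal.span_minimal[OF xs ideal_\<mm>])
  have quotient: "ideal_mult poly_scale (Sym_pow n) (Rees_pow E n) xs = quotient_kernel J n" for n
    unfolding J by (rule ideal_mult_Rees_pow)
  from socle_eventually_constant[OF sJ] show ?thesis
  proof
    assume "\<exists>n\<^sub>0. \<forall>n\<ge>n\<^sub>0. has_nonzero_socle (Sym_pow n) (quotient_kernel J n)"
    then obtain n2 where n2: "\<And>n. n \<ge> n2 \<Longrightarrow> has_nonzero_socle (Sym_pow n) (quotient_kernel J n)" by blast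
    have "depth_quotient poly_scale \<mm> (Sym_pow n) (Rees_pow E n) = enat (length xs)"
      if "n \<ge> max n1 n2" for n
      by (rule depth_quotient_eq_length[OF noetherian_Sym_pow[OF ideals_noetherian] subspace_Sym_pow
            subspace_Rees_pow Rees_pow_subset_Sym_pow xs])
        (use that n1 n2 in \<open>simp_all add: quotient\<close>)
    then show ?thesis by blast
  next
    assume "\<exists>n\<^sub>0. \<forall>n\<ge>n\<^sub>0. \<not> has_nonzero_socle (Sym_pow n) (quotient_kernel J n)"
    then obtain n2 where "\<And>n. n \<ge> n2 \<Longrightarrow> \<not> has_nonzero_socle (Sym_pow n) (quotient_kernel J n)" by blast
    then obtain x where x: "x \<in> \<mm>"
      "\<And>n. n \<ge> n2 \<Longrightarrow> P.regular_on (Sym_pow n) (quotient_kernel J n) x"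
      using eventually_common_regular_element[OF sJ, of n2] by blast
    have "P.weakly_regular (Sym_pow n) (Rees_pow E n) (xs @ [x])" if "n \<ge> max n1 n2" for n
      unfolding P.weakly_regular_snoc quotient using that n1 x(2) by simp
    then have "good (xs @ [x])" using xs x(1) unfolding good_def by (intro conjI exI[of _ "max n1 n2"]) auto
    moreover have "J \<subseteq> ?I (xs @ [x])" unfolding J by (rule ideal.span_mono) auto
    ultimately have "?I (xs @ [x]) = J" using max by blast
    then have "x \<in> J" using ideal.span_base[of x "set (xs @ [x])"] by simp
    obtain p where p: "p \<in> Sym_pow (Suc n2)" "p \<notin> quotient_kernel J (Suc n2)"
      using quotient_nonzero[OF \<open>J \<subseteq> \<mm>\<close>] by blast
    have "poly_scale x p \<in> quotient_kernel J (Suc n2)"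
      by (rule coeffs_in_subset_mod[OF sJ P.subspace_scale[OF subspace_Sym_pow p(1)]
            poly_scale_in_coeffs_in[OF sJ \<open>x \<in> J\<close>]])
    then have False using x(2)[of "Suc n2"] p unfolding P.regular_on_def by simp
    then show ?thesis ..
  qed
qed

end

theorem theorem3p3:
  fixes \<mm> :: "'a::comm_ring_1 set"
    and E :: "('a ^ 'e::finite) set"
  assumes "noetherian_local_ring \<mm>"
    and "module.subspace (*s) E"
    and "E \<noteq> UNIV"
  shows "\<exists>n\<^sub>0. \<forall>n\<ge>n\<^sub>0.
           depth_quotient poly_scale \<mm> (Sym_pow n) (Rees_pow E n)
         = depth_quotient poly_scale \<mm> (Sym_pow n\<^sub>0) (Rees_pow E n\<^sub>0)"
proof -
  interpret proper_submodule \<mm> E by unfold_locales (rule assms)+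
  obtain d n\<^sub>0 where d: "\<And>n. n \<ge> n\<^sub>0 \<Longrightarrow> depth_quotient poly_scale \<mm> (Sym_pow n) (Rees_pow E n) = d"
    using depth_eventually_constant by blast
  show ?thesis by (intro exI[of _ n\<^sub>0] allI impI) (simp add: d)
qed

end
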